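(* For each $n\ge 1$ let $\varphi_n:[0,\infty)\to[0,\infty)$ be a measurable function, let $(Z_1,\dots,Z_n)=(Z_{n,1},\dots,Z_{n,n})\in\mathbb{C}^n$ be a random vector whose density with respect to Lebesgue measure on $\mathbb{C}^n$ is proportional to $$\prod_{1\le j<k\le n}|z_j-z_k|^2\cdot\prod_{j=1}^n\varphi_n(|z_j|),$$ and let $Y_1,\dots,Y_n$ $(=Y_{n,1},\dots,Y_{n,n})$ be independent random variables such that, for every $1\le j\le n$, the density of $Y_j$ is proportional to $y^{2j-1}\varphi_n(y)I(y\ge 0)$. (i) Let $h_n:[0,\infty)\to\mathbb{R}$, $n\ge1$, be measurable functions and set $$\mu_n=\frac1n\sum_{j=1}^n\delta_{(\Theta_j,\,h_n(|Z_j|))},\qquad \nu_n=\frac1n\sum_{j=1}^n\delta_{h_n(Y_j)}.$$ If $\nu_n\rightsquigarrow\nu$ for some (non-random) probability measure $\nu$, then $\mu_n\rightsquigarrow\mu$, where $\mu=Unif[0,2\pi]\otimes\nu$. (ii) Let $\{a_n\}_{n\ge1}$ be a sequence of positive numbers and set $$\mu_n^*=\frac1n\sum_{j=1}^n\delta_{Z_j/a_n},\qquad \nu_n^*=\frac1n\sum_{j=1}^n\delta_{Y_j/a_n}.$$ If $\nu_n^*\rightsquigarrow\nu^*$ for some (non-random) probability measure $\nu^*$, then $\mu_n^*\rightsquigarrow\mu^*$, where $\mu^*$ is the distribution of $Re^{i\Theta}$ with $(\Theta,R)$ having the law $Unif[0,2\pi]\otimes\nu^*$.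
   Context: All random variables (for all $n$) are defined on a common probability space. For random probability measures $\upsilon_n$ and a probability measure $\upsilon$, $\upsilon_n\rightsquigarrow\upsilon$ means $P(\upsilon_n\text{ converges weakly to }\upsilon\text{ as }n\to\infty)=1$. $\Theta_j=\arg(Z_j)\in[0,2\pi)$ is the argument, so that $Z_j=|Z_j|e^{i\Theta_j}$. $Unif(A)$ is the uniform distribution on $A$, $\delta_x$ is the point mass at $x$, $I(\cdot)$ is the indicator, and $\otimes$ denotes product measure. "Density proportional to" presupposes that the expression is normalizable. *)

theory Defs
  imports "HOL-Probability.Probability"
begin

text \<open>
  The density of \<open>X\<close> with respect to \<open>N\<close> is proportional to the nonnegative function \<open>f\<close>.
  For a probability measure \<open>P\<close> the existence of the constant \<open>c\<close> entails that the integral of \<open>f\<close> is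
  positive and finite, i.e. that \<open>f\<close> is normalizable.
\<close>

definition density_proportional_to ::
  "'a measure \<Rightarrow> 'b measure \<Rightarrow> ('a \<Rightarrow> 'b) \<Rightarrow> ('b \<Rightarrow> real) \<Rightarrow> bool" where
  "density_proportional_to P N X f \<longleftrightarrow> (\<exists>c>0. distributed P N X (\<lambda>x. ennreal (c * f x)))"

lemma density_proportional_to_normalizable:
  assumes "prob_space P" and "density_proportional_to P N X f"
    and f: "f \<in> borel_measurable N" and nonneg: "\<And>x. x \<in> space N \<Longrightarrow> 0 \<le> f x"
  shows "integrable N f" and "0 < integral\<^sup>L N f"
proof -
  obtain c where c: "c > 0" and d: "distributed P N X (\<lambda>x. ennreal (c * f x))"
    using assms(2) by (auto simp: density_proportional_to_def)
  interpret prob_space P by fact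
  have "prob_space (density N (\<lambda>x. ennreal (c * f x)))"
    using d prob_space_distr unfolding distributed_def by metis
  then have 1: "(\<integral>\<^sup>+x. ennreal (c * f x) \<partial>N) = 1"
    using d by (auto simp: emeasure_density distributed_def dest!: prob_space.emeasure_space_1
        intro!: nn_integral_cong_simp split: split_indicator)
  have nn: "AE x in N. 0 \<le> c * f x" using c nonneg by auto
  have i: "integrable N (\<lambda>x. c * f x)"
    using 1 f nn by (intro integrableI_nonneg) auto
  have I: "integral\<^sup>L N (\<lambda>x. c * f x) = 1"
    using 1 nn f by (subst integral_eq_nn_integral) auto
  show "integrable N f" using i c by simp
  show "0 < integral\<^sup>L N f" using I c by (metis integral_mult_right_zero zero_less_mult_pos zero_less_one)
qed

definition empirical_measure :: "nat \<Rightarrow> (nat \<Rightarrow> 'b::topological_space) \<Rightarrow> 'b measure" where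
  "empirical_measure n x = distr (uniform_count_measure {1..n}) borel x"

lemma measurable_uniform_count_measure:
  "x \<in> measurable (uniform_count_measure A) (borel :: 'b::topological_space measure)"
  by (subst measurable_cong_sets[OF sets_uniform_count_measure_count_space refl]) simp

text \<open>The measure \<open>(1 / n) * (\<Sum>j = 1..n. \<delta> (x j))\<close>.\<close>

lemma measure_empirical_measure:
  assumes "A \<in> sets borel"
  shows "measure (empirical_measure n x) A = (1 / real n) * (\<Sum>j=1..n. indicator A (x j))"
proof -
  have "measure (empirical_measure n x) A = measure (uniform_count_measure {1..n}) (x -` A \<inter> {1..n})"
    unfolding empirical_measure_def using assms
    by (subst measure_distr) (auto simp: measurable_uniform_count_measure space_uniform_count_measure)
  also have "\<dots> = card (x -` A \<inter> {1..n}) / n"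
    by (subst measure_uniform_count_measure) auto
  also have "real (card (x -` A \<inter> {1..n})) = (\<Sum>j=1..n. indicator A (x j))"
    by (simp add: indicator_def sum.If_cases Int_def conj_commute)
  finally show ?thesis by simp
qed

lemma prob_space_empirical_measure:
  "n \<ge> 1 \<Longrightarrow> prob_space (empirical_measure n x)"
  unfolding empirical_measure_def
  by (intro prob_space.prob_space_distr prob_space_uniform_count_measure measurable_uniform_count_measure)
    auto

definition weakly_converges ::
  "(nat \<Rightarrow> 'b::topological_space measure) \<Rightarrow> 'b measure \<Rightarrow> bool" where
  "weakly_converges \<upsilon>s \<upsilon> \<longleftrightarrow>
     (\<forall>f :: 'b \<Rightarrow> real. continuous_on UNIV f \<and> bounded (range f) \<longrightarrow>
        (\<lambda>n. \<integral>x. f x \<partial>\<upsilon>s n) \<longlonglongrightarrow> (\<integral>x. f x \<partial>\<upsilon>))"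

text \<open>
  \<^const>\<open>weak_conv_m\<close> is only available on the real line, whereas limits on the plane are needed as well;
  on the real line the two notions agree.
\<close>

lemma weakly_converges_iff_weak_conv_m:
  assumes "\<And>n. real_distribution (\<upsilon>s n)" and "real_distribution \<upsilon>"
  shows "weakly_converges \<upsilon>s \<upsilon> \<longleftrightarrow> weak_conv_m \<upsilon>s \<upsilon>"
proof
  assume w: "weakly_converges \<upsilon>s \<upsilon>"
  show "weak_conv_m \<upsilon>s \<upsilon>"
    using assms
  proof (rule integral_bdd_continuous_conv_imp_weak_conv)
    fix f :: "real \<Rightarrow> real" assume "\<And>x. isCont f x" "\<And>x. \<bar>f x\<bar> \<le> 1"
    then show "(\<lambda>n. integral\<^sup>L (\<upsilon>s n) f) \<longlonglongrightarrow> integral\<^sup>L \<upsilon> f"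
      using w by (auto simp: weakly_converges_def bounded_iff intro!: continuous_at_imp_continuous_on)
  qed
next
  assume w: "weak_conv_m \<upsilon>s \<upsilon>"
  show "weakly_converges \<upsilon>s \<upsilon>"
    unfolding weakly_converges_def
  proof (intro allI impI)
    fix f :: "real \<Rightarrow> real" assume f: "continuous_on UNIV f \<and> bounded (range f)"
    then obtain B where "\<And>x. norm (f x) \<le> B" by (auto simp: bounded_iff)
    moreover have "\<And>x. isCont f x" using f by (simp add: continuous_on_eq_continuous_at)
    ultimately show "(\<lambda>n. \<integral>x. f x \<partial>\<upsilon>s n) \<longlonglongrightarrow> (\<integral>x. f x \<partial>\<upsilon>)"
      using weak_conv_imp_integral_bdd_continuous_conv[OF assms w] by blast
  qed
qed

text \<open>Almost sure weak convergence of random measures \<open>\<upsilon>s n \<omega>\<close> to a non-random limit.\<close>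

definition as_weakly_converges ::
  "'a measure \<Rightarrow> (nat \<Rightarrow> 'a \<Rightarrow> 'b::topological_space measure) \<Rightarrow> 'b measure \<Rightarrow> bool" where
  "as_weakly_converges P \<upsilon>s \<upsilon> \<longleftrightarrow> (AE \<omega> in P. weakly_converges (\<lambda>n. \<upsilon>s n \<omega>) \<upsilon>)"

end

theory Submission
  imports Defs "Jordan_Normal_Form.Determinant"
begin

text \<open>
  For a bounded measurable \<open>g\<close>, expanding the Vandermonde determinant in monic polynomials that are
  orthogonal for the weight \<open>exp (g z) * \<phi> \<bar>z\<bar>\<close> shows that \<open>E (exp (\<Sum>j. g (Z j)))\<close> is a constant times the
  product of their squared norms. These are at most the squared norms of the monomials \<open>z ^ i\<close>, with
  equality for \<open>g = 0\<close>, where the monomials are already orthogonal by rotation invariance. Hence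
  \<open>E (exp (\<Sum>j. g (Z j))) \<le> (\<Prod>j. E (exp (g (Y j * exp (\<i> * \<Theta>)))))\<close> with \<open>\<Theta>\<close> uniform and independent of \<open>Y j\<close>,
  as if the points were independent. Hoeffding's lemma turns this into an exponential bound for the
  deviation of the linear statistic from its mean, and by Borel--Cantelli the deviation tends to \<open>0\<close>
  almost surely whatever the coupling between different \<open>n\<close>. The mean itself is the expectation
  of an integral against \<open>\<nu>\<^sub>n\<close> and converges by dominated convergence. Testing on a countable
  family of functions gives (i), and (ii) follows by continuous mapping.
\<close>

subsection \<open>Vandermonde integrals\<close>

text \<open>The index shift that ties both ensembles together: in polar coordinates the weight
  \<open>cmod z ^ (2 * i) * \<phi> (cmod z)\<close> gains the Jacobian \<open>r\<close>, so its
  radial density is proportional to \<open>r ^ (2 * Suc i - 1) * \<phi> r\<close>, which is that of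
  \<open>Y (Suc i)\<close>. The squared norm of the monomial \<open>z ^ i\<close> is thus the
  inverse normalizer of a planar law with radius \<open>Y (Suc i)\<close> and uniform angle, and the
  equality case \<open>g = 0\<close> makes all normalizers cancel exactly. The test functions of
  interest, \<open>s (Arg2pi z, h (cmod z))\<close>, need not be continuous in \<open>z\<close>,
  because \<open>h\<close> is merely measurable and \<open>Arg2pi\<close> jumps. The exponential
  bound therefore has to hold for every bounded measurable \<open>g\<close>. Continuity matters only
  after averaging over the angle: the mean of \<open>s (\<theta>, r)\<close> over
  \<open>\<theta>\<close> is bounded and continuous in \<open>r\<close>, and it is to this function
  that the assumed convergence of \<open>\<nu>\<^sub>n\<close> is applied.\<close>

lemma det_monic_poly_eval:
  fixes q :: "nat \<Rightarrow> 'a::idom poly" and x :: "nat \<Rightarrow> 'a"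
  assumes "\<And>i. i < n \<Longrightarrow> degree (q i) = i" "\<And>i. i < n \<Longrightarrow> lead_coeff (q i) = 1"
  shows "det (mat n n (\<lambda>(i, j). poly (q i) (x j))) = det (mat n n (\<lambda>(i, j). x j ^ i))"
proof -
  \<comment> \<open>\<open>T\<close> is the change of basis from monomials to the
    \<open>q i\<close>. Monic polynomials of degree \<open>i\<close> make it lower triangular with
    unit diagonal.\<close>
  define T where "T = mat n n (\<lambda>(i, k). coeff (q i) k)"
  define V where "V = mat n n (\<lambda>(i, j). x j ^ i)"
  have "mat n n (\<lambda>(i, j). poly (q i) (x j)) = T * V"
  proof (rule eq_matI)
    fix i j assume ij: "i < dim_row (T * V)" "j < dim_col (T * V)"
    then have "poly (q i) (x j) = (\<Sum>k\<le>i. coeff (q i) k * x j ^ k)"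
      using assms(1)[of i] by (simp add: poly_altdef T_def V_def)
    also have "\<dots> = (\<Sum>k\<in>{0..<n}. coeff (q i) k * x j ^ k)"
      using ij assms(1)[of i] by (intro sum.mono_neutral_left)
        (auto simp: T_def V_def intro!: coeff_eq_0)
    also have "\<dots> = (T * V) $$ (i, j)"
      using ij by (simp add: T_def V_def times_mat_def scalar_prod_def)
    finally show "mat n n (\<lambda>(i, j). poly (q i) (x j)) $$ (i, j) = (T * V) $$ (i, j)"
      using ij by (simp add: T_def V_def)
  qed (simp_all add: T_def V_def)
  moreover have "det T = 1"
  proof -
    have "det T = prod_list (diag_mat T)"
      by (rule det_lower_triangular[of n]) (auto simp: T_def assms(1) intro!: coeff_eq_0)
    also have "diag_mat T = map (\<lambda>_. 1) [0..<n]"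
      using assms by (auto simp: diag_mat_def T_def intro!: map_cong)
    finally show ?thesis by (simp add: map_replicate_const)
  qed
  moreover have "det (T * V) = det T * det V"
    by (rule det_mult[where n = n]) (simp_all add: T_def V_def)
  ultimately show ?thesis
    unfolding V_def[symmetric] by simp
qed

text \<open>Evaluating the Newton polynomials \<open>\<Prod>i<k. (X - x i)\<close> gives a triangular matrix.\<close>

lemma det_vandermonde_monic:
  fixes q :: "nat \<Rightarrow> 'a::idom poly" and x :: "nat \<Rightarrow> 'a"
  assumes "\<And>i. i < n \<Longrightarrow> degree (q i) = i" "\<And>i. i < n \<Longrightarrow> lead_coeff (q i) = 1"
  shows "det (mat n n (\<lambda>(i, j). poly (q i) (x j))) = (\<Prod>k<n. \<Prod>j<k. x k - x j)"
proof -
  define r where "r = (\<lambda>i. \<Prod>j<i. [:- x j, 1:])"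
  have "det (mat n n (\<lambda>(i, j). poly (q i) (x j))) = det (mat n n (\<lambda>(i, j). poly (r i) (x j)))"
  proof -
    have "degree (r i) = i" for i
      by (simp add: r_def degree_prod_sum_eq)
    moreover have "lead_coeff (r i) = 1" for i
      unfolding r_def lead_coeff_prod by simp
    ultimately show ?thesis
      using det_monic_poly_eval[OF assms] det_monic_poly_eval[of n r x] by metis
  qed
  also have "\<dots> = prod_list (diag_mat (mat n n (\<lambda>(i, j). poly (r i) (x j))))"
    by (rule det_upper_triangular[of _ n])
      (auto simp: upper_triangular_def r_def poly_prod)
  also have "\<dots> = (\<Prod>k<n. \<Prod>j<k. x k - x j)"
    by (simp add: diag_mat_def r_def poly_prod prod.distinct_set_conv_list[symmetric] atLeast0LessThan
       cong: map_cong)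
  finally show ?thesis .
qed

text \<open>Bridges the 1-based pairs in the joint density and the 0-based iterated product that
  comes out of the determinant.\<close>

lemma prod_pairs_Suc:
  fixes g :: "nat \<Rightarrow> nat \<Rightarrow> 'a::comm_monoid_mult"
  shows "(\<Prod>(j, k)\<in>{(j, k). 1 \<le> j \<and> j < k \<and> k \<le> n}. g j k) = (\<Prod>k<n. \<Prod>j<k. g (Suc j) (Suc k))"
proof -
  have "(\<Prod>k<n. \<Prod>j<k. g (Suc j) (Suc k)) = (\<Prod>(k, j)\<in>(SIGMA k:{..<n}. {..<k}). g (Suc j) (Suc k))"
    by (rule prod.Sigma) auto
  also have "\<dots> = (\<Prod>(j, k)\<in>{(j, k). 1 \<le> j \<and> j < k \<and> k \<le> n}. g j k)"
    by (rule prod.reindex_bij_witness[of _ "\<lambda>(j, k). (k - 1, j - 1)" "\<lambda>(k, j). (Suc j, Suc k)"]) auto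
  finally show ?thesis by simp
qed

text \<open>The sesquilinear form of L2 with weight \<open>w\<close>, conjugate linear in the last
  argument. It is degenerate if \<open>w\<close> vanishes almost everywhere, and the integral
  defaults to 0 outside the integrable case, so additivity is only available under
  integrability.\<close>

definition weighted_inner :: "(complex \<Rightarrow> real) \<Rightarrow> complex poly \<Rightarrow> complex poly \<Rightarrow> complex" where
  "weighted_inner w p q = (\<integral>z. poly p z * cnj (poly q z) * complex_of_real (w z) \<partial>lborel)"

text \<open>An Andreief-type identity. The squared Vandermonde product is a determinant in the
  \<open>q i\<close> times its conjugate; expanding both over permutations makes every term a
  product over the coordinates, and orthogonality leaves only the \<open>fact n\<close> terms with
  equal permutations.\<close>

lemma integral_vandermonde_orthogonal:
  fixes q :: "nat \<Rightarrow> complex poly" and w :: "complex \<Rightarrow> real"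
  assumes monic: "\<And>i. i < n \<Longrightarrow> degree (q i) = i" "\<And>i. i < n \<Longrightarrow> lead_coeff (q i) = 1"
  and int: "\<And>i j. i < n \<Longrightarrow> j < n \<Longrightarrow>
    integrable lborel (\<lambda>z. poly (q i) z * cnj (poly (q j) z) * complex_of_real (w z))"
  and orth: "\<And>i j. i < n \<Longrightarrow> j < n \<Longrightarrow> i \<noteq> j \<Longrightarrow> weighted_inner w (q i) (q j) = 0"
  defines "F \<equiv> \<lambda>z::nat \<Rightarrow> complex. (\<Prod>(j, k)\<in>{(j, k). 1 \<le> j \<and> j < k \<and> k \<le> n}. (cmod (z j - z k))\<^sup>2) *
             (\<Prod>j=1..n. w (z j))"
  shows "integrable (\<Pi>\<^sub>M j\<in>{1..n}. lborel) F"
    and "complex_of_real (\<integral>z. F z \<partial>(\<Pi>\<^sub>M j\<in>{1..n}. lborel)) =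
         fact n * (\<Prod>i<n. weighted_inner w (q i) (q i))"
proof -
  interpret product_sigma_finite "\<lambda>_::nat. lborel :: complex measure"
    by standard
  define f where "f \<sigma> \<tau> k = (\<lambda>z. poly (q (\<sigma> (k - 1))) z * cnj (poly (q (\<tau> (k - 1))) z) *
      complex_of_real (w z))" for \<sigma> \<tau> :: "nat \<Rightarrow> nat" and k :: nat
  define S where "S = {\<sigma>. \<sigma> permutes {0..<n}}"
  have finS: "finite S" by (simp add: S_def finite_permutations)
  have "complex_of_real (F z) =
    (\<Sum>\<sigma>\<in>S. \<Sum>\<tau>\<in>S. signof \<sigma> * signof \<tau> * (\<Prod>k=1..n. f \<sigma> \<tau> k (z k)))" for z
  proof -
    define D where "D = det (mat n n (\<lambda>(i, j). poly (q i) (z (Suc j))))"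
    \<comment> \<open>Transposing lets the permutation act on the polynomial index, so that each
      coordinate occurs in exactly one factor.\<close>
    have "D = det (transpose_mat (mat n n (\<lambda>(i, j). poly (q i) (z (Suc j)))))"
      unfolding D_def by (subst det_transpose[where n=n]) auto
    also have "\<dots> = (\<Sum>\<sigma>\<in>S. signof \<sigma> * (\<Prod>i = 0..<n. poly (q (\<sigma> i)) (z (Suc i))))"
      by (subst det_def'[where n=n]) (auto simp: S_def intro!: sum.cong prod.cong)
    also have "\<dots> = (\<Sum>\<sigma>\<in>S. signof \<sigma> * (\<Prod>k=1..n. poly (q (\<sigma> (k - 1))) (z k)))"
      by (intro sum.cong arg_cong2[where f="(*)"] refl
          prod.reindex_bij_witness[of _ "\<lambda>k. k - 1" Suc]) auto
    finally have D: "D = (\<Sum>\<sigma>\<in>S. signof \<sigma> * (\<Prod>k=1..n. poly (q (\<sigma> (k - 1))) (z k)))" .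
    have cnj_sign: "cnj (signof \<tau>) = signof \<tau>" for \<tau> :: "nat \<Rightarrow> nat" by (simp add: sign_def)
    have "D = (\<Prod>k<n. \<Prod>j<k. z (Suc k) - z (Suc j))"
      unfolding D_def by (rule det_vandermonde_monic[OF monic])
    then have "(cmod D)\<^sup>2 = (\<Prod>k<n. \<Prod>j<k. (cmod (z (Suc j) - z (Suc k)))\<^sup>2)"
      by (simp add: prod_norm[symmetric] prod_power_distrib[symmetric] norm_minus_commute)
    then have "F z = (cmod D)\<^sup>2 * (\<Prod>j=1..n. w (z j))"
      unfolding F_def prod_pairs_Suc by simp
    then have "complex_of_real (F z) = D * cnj D * (\<Prod>j=1..n. complex_of_real (w (z j)))"
      by (simp only: of_real_mult complex_norm_square of_real_prod)
    also have "D * cnj D * (\<Prod>j=1..n. complex_of_real (w (z j))) =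
       (\<Sum>\<sigma>\<in>S. \<Sum>\<tau>\<in>S. signof \<sigma> * signof \<tau> * (\<Prod>k=1..n. f \<sigma> \<tau> k (z k)))"
    proof -
      define a where "a = (\<lambda>\<sigma>. \<Prod>k=1..n. poly (q (\<sigma> (k - 1))) (z k))"
      define b where "b = (\<Prod>j=1..n. complex_of_real (w (z j)))"
      have f: "(\<Prod>k=1..n. f \<sigma> \<tau> k (z k)) = a \<sigma> * cnj (a \<tau>) * b" for \<sigma> \<tau>
        unfolding f_def prod.distrib a_def b_def cnj_prod ..
      have Da: "D = (\<Sum>\<sigma>\<in>S. signof \<sigma> * a \<sigma>)" unfolding D a_def ..
      then have "cnj D = (\<Sum>\<tau>\<in>S. signof \<tau> * cnj (a \<tau>))"
        by (simp only: cnj_sum complex_cnj_mult cnj_sign)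
      with Da have "D * cnj D = (\<Sum>\<sigma>\<in>S. \<Sum>\<tau>\<in>S. signof \<sigma> * a \<sigma> * (signof \<tau> * cnj (a \<tau>)))"
        by (simp only: sum_product)
      then show ?thesis
        unfolding f b_def[symmetric] by (simp only: sum_distrib_right) (simp only: mult_ac)
    qed
    finally show ?thesis .
  qed
  note F_eq = this
  have perm: "\<sigma> (k - 1) < n" if "\<sigma> \<in> S" "k \<in> {1..n}" for \<sigma> k
    using that permutes_in_image[of \<sigma> "{0..<n}" "k - 1"] by (auto simp: S_def)
  have int_f: "integrable lborel (f \<sigma> \<tau> k)" if "\<sigma> \<in> S" "\<tau> \<in> S" "k \<in> {1..n}" for \<sigma> \<tau> k
    unfolding f_def using that perm by (intro int) auto
  have int1: "integrable (\<Pi>\<^sub>M j\<in>{1..n}. lborel) (\<lambda>z. \<Prod>k=1..n. f \<sigma> \<tau> k (z k))"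
    if "\<sigma> \<in> S" "\<tau> \<in> S" for \<sigma> \<tau>
    using that by (intro product_integrable_prod int_f) auto
  have I: "(\<integral>z. (\<Prod>k=1..n. f \<sigma> \<tau> k (z k)) \<partial>(\<Pi>\<^sub>M j\<in>{1..n}. lborel)) =
     (if \<tau> = \<sigma> then (\<Prod>i<n. weighted_inner w (q i) (q i)) else 0)"
    if S: "\<sigma> \<in> S" "\<tau> \<in> S" for \<sigma> \<tau>
  proof -
    have *: "(\<integral>z. (\<Prod>k=1..n. f \<sigma> \<tau> k (z k)) \<partial>(\<Pi>\<^sub>M j\<in>{1..n}. lborel)) =
       (\<Prod>k=1..n. weighted_inner w (q (\<sigma> (k - 1))) (q (\<tau> (k - 1))))"
      using S by (subst product_integral_prod[OF _ int_f]) (auto simp: f_def weighted_inner_def)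
    show ?thesis
    proof (cases "\<tau> = \<sigma>")
      case True
      have "(\<Prod>k=1..n. weighted_inner w (q (\<sigma> (k - 1))) (q (\<sigma> (k - 1)))) =
        (\<Prod>i\<in>{0..<n}. weighted_inner w (q (\<sigma> i)) (q (\<sigma> i)))"
        by (rule prod.reindex_bij_witness[of _ Suc "\<lambda>k. k - 1"]) auto
      also have "\<dots> = (\<Prod>i\<in>{0..<n}. weighted_inner w (q i) (q i))"
        using S(1) prod.permute[of \<sigma> "{0..<n}" "\<lambda>i. weighted_inner w (q i) (q i)"]
        by (simp add: S_def comp_def)
      finally show ?thesis unfolding * using True by (simp add: atLeast0LessThan)
    next
      case False
      \<comment> \<open>Permutations that differ at \<open>i\<close> put two different orthogonal
        polynomials into coordinate \<open>Suc i\<close>, and this single vanishing factor kills the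
        product.\<close>
      then obtain i where i: "\<sigma> i \<noteq> \<tau> i" by (metis ext)
      then have "i \<in> {0..<n}"
        using S permutes_not_in[of \<sigma> "{0..<n}" i] permutes_not_in[of \<tau> "{0..<n}" i]
        unfolding S_def by fastforce
      then have k: "Suc i \<in> {1..n}" by auto
      have "weighted_inner w (q (\<sigma> (Suc i - 1))) (q (\<tau> (Suc i - 1))) = 0"
        using perm[OF S(1) k] perm[OF S(2) k] i by (intro orth) auto
      then have "(\<Prod>k=1..n. weighted_inner w (q (\<sigma> (k - 1))) (q (\<tau> (k - 1)))) = 0"
        using k by (intro prod_zero bexI[of _ "Suc i"]) auto
      then show ?thesis unfolding * using False by simp
    qed
  qed
  have int2: "integrable (\<Pi>\<^sub>M j\<in>{1..n}. lborel) (\<lambda>z. complex_of_real (F z))"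
    unfolding F_eq by (intro Bochner_Integration.integrable_sum integrable_mult_right int1)
  then show "integrable (\<Pi>\<^sub>M j\<in>{1..n}. lborel) F" 
    using integrable_Re[OF int2] by simp
  have "complex_of_real (\<integral>z. F z \<partial>(\<Pi>\<^sub>M j\<in>{1..n}. lborel)) =
     (\<integral>z. (\<Sum>\<sigma>\<in>S. \<Sum>\<tau>\<in>S. signof \<sigma> * signof \<tau> * (\<Prod>k=1..n. f \<sigma> \<tau> k (z k))) \<partial>(\<Pi>\<^sub>M j\<in>{1..n}. lborel))"
    by (simp only: integral_complex_of_real[symmetric] F_eq)
  also have "\<dots> = (\<Sum>\<sigma>\<in>S. \<integral>z. (\<Sum>\<tau>\<in>S. signof \<sigma> * signof \<tau> * (\<Prod>k=1..n. f \<sigma> \<tau> k (z k))) \<partial>(\<Pi>\<^sub>M j\<in>{1..n}. lborel))"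
    by (intro Bochner_Integration.integral_sum Bochner_Integration.integrable_sum integrable_mult_right int1)
  also have "\<dots> = (\<Sum>\<sigma>\<in>S. \<Sum>\<tau>\<in>S. \<integral>z. signof \<sigma> * signof \<tau> * (\<Prod>k=1..n. f \<sigma> \<tau> k (z k)) \<partial>(\<Pi>\<^sub>M j\<in>{1..n}. lborel))"
    by (intro sum.cong refl Bochner_Integration.integral_sum integrable_mult_right int1)
  also have "\<dots> = (\<Sum>\<sigma>\<in>S. \<Sum>\<tau>\<in>S. if \<tau> = \<sigma> then (\<Prod>i<n. weighted_inner w (q i) (q i)) else 0)"
    by (intro sum.cong refl, simp only: integral_mult_right_zero I) (simp add: sign_def)
  also have "\<dots> = fact n * (\<Prod>i<n. weighted_inner w (q i) (q i))"
    using finS card_permutations[OF _ finite_atLeastLessThan, of 0 n n] by (simp add: S_def)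
  finally show "complex_of_real (\<integral>z. F z \<partial>(\<Pi>\<^sub>M j\<in>{1..n}. lborel)) =
         fact n * (\<Prod>i<n. weighted_inner w (q i) (q i))" .
qed

section \<open>Rules for the weighted form and Gram--Schmidt orthogonalization\<close>

lemma weighted_inner_sum_left:
  "finite A \<Longrightarrow> (\<And>a. a \<in> A \<Longrightarrow> integrable lborel (\<lambda>z. poly (p a) z * cnj (poly q z) * complex_of_real (w z))) \<Longrightarrow>
    weighted_inner w (\<Sum>a\<in>A. Polynomial.smult (c a) (p a)) q = (\<Sum>a\<in>A. c a * weighted_inner w (p a) q)"
  unfolding weighted_inner_def
  by (simp add: poly_sum sum_distrib_right mult.assoc Bochner_Integration.integral_sum)

lemma weighted_inner_diff_left:
  "integrable lborel (\<lambda>z. poly p z * cnj (poly q z) * complex_of_real (w z)) \<Longrightarrow>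
   integrable lborel (\<lambda>z. poly p' z * cnj (poly q z) * complex_of_real (w z)) \<Longrightarrow>
    weighted_inner w (p - p') q = weighted_inner w p q - weighted_inner w p' q"
  unfolding weighted_inner_def by (simp add: left_diff_distrib)

lemma weighted_inner_commute: "weighted_inner w q p = cnj (weighted_inner w p q)"
  unfolding weighted_inner_def Bochner_Integration.integral_cnj[symmetric] by (simp add: mult_ac)

lemma weighted_inner_self:
  "weighted_inner w p p = complex_of_real (\<integral>z. (cmod (poly p z))\<^sup>2 * w z \<partial>lborel)"
  unfolding weighted_inner_def integral_complex_of_real[symmetric]
  by (simp only: of_real_mult complex_norm_square)

text \<open>Mixed moments are controlled by the even ones through
  \<open>a * b \<le> a\<^sup>2 + b\<^sup>2\<close> with \<open>a = cmod z ^ i\<close> and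
  \<open>b = cmod z ^ j\<close>; polynomials follow by expansion.\<close>

lemma integrable_weighted_inner:
  assumes w[measurable]: "w \<in> borel_measurable borel" and nn: "\<And>z. 0 \<le> w z"
    and mom: "\<And>i. i < n \<Longrightarrow> integrable lborel (\<lambda>z. cmod z ^ (2 * i) * w z)"
    and deg: "\<And>i. n \<le> i \<Longrightarrow> coeff p i = 0" "\<And>i. n \<le> i \<Longrightarrow> coeff q i = 0"
  shows "integrable lborel (\<lambda>z. poly p z * cnj (poly q z) * complex_of_real (w z))"
proof -
  have poly_eq: "poly p z = (\<Sum>i<n. coeff p i * z ^ i)" if "\<And>i. n \<le> i \<Longrightarrow> coeff p i = 0" for p and z :: complex
  proof -
    have "poly p z = (\<Sum>i\<le>degree p. coeff p i * z ^ i)" by (simp add: poly_altdef)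
    also have "\<dots> = (\<Sum>i\<in>{..degree p} \<inter> {..<n}. coeff p i * z ^ i)"
      using that by (intro sum.mono_neutral_right) (auto simp: not_less)
    also have "\<dots> = (\<Sum>i<n. coeff p i * z ^ i)"
      by (intro sum.mono_neutral_left) (auto intro!: coeff_eq_0)
    finally show ?thesis .
  qed
  have mono: "integrable lborel (\<lambda>z. z ^ i * cnj (z ^ j) * complex_of_real (w z))" if "i < n" "j < n" for i j
  proof (rule Bochner_Integration.integrable_bound)
    show "integrable lborel (\<lambda>z. cmod z ^ (2 * i) * w z + cmod z ^ (2 * j) * w z)"
      using that by (intro Bochner_Integration.integrable_add mom)
    have "norm (z ^ i * cnj (z ^ j) * complex_of_real (w z)) \<le> cmod z ^ (2 * i) * w z + cmod z ^ (2 * j) * w z" for z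
    proof -
      have "2 * (cmod z ^ i * cmod z ^ j) \<le> cmod z ^ (2 * i) + cmod z ^ (2 * j)"
        using sum_squares_bound[of "cmod z ^ i" "cmod z ^ j"] by (simp only: power_even_eq mult.assoc)
      moreover have "0 \<le> cmod z ^ i * cmod z ^ j" by simp
      ultimately have "cmod z ^ i * cmod z ^ j \<le> cmod z ^ (2 * i) + cmod z ^ (2 * j)" by linarith
      then show ?thesis
        using nn[of z] by (simp add: norm_mult norm_power mult_right_mono flip: distrib_right)
    qed
    then show "AE z in lborel. norm (z ^ i * cnj (z ^ j) * complex_of_real (w z)) \<le>
        norm (cmod z ^ (2 * i) * w z + cmod z ^ (2 * j) * w z)"
      by (intro always_eventually allI) (smt (verit) real_norm_def)
    show "(\<lambda>z. z ^ i * cnj (z ^ j) * complex_of_real (w z)) \<in> borel_measurable lborel"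
    proof -
      have [measurable]: "cnj \<in> borel_measurable borel"
        using continuous_on_cnj[OF continuous_on_id] by (rule borel_measurable_continuous_onI)
      show ?thesis by measurable
    qed
  qed
  have "poly p z * cnj (poly q z) * complex_of_real (w z) =
    (\<Sum>i<n. \<Sum>j<n. (coeff p i * cnj (coeff q j)) * (z ^ i * cnj (z ^ j) * complex_of_real (w z)))" for z
  proof -
    have "poly p z = (\<Sum>i<n. coeff p i * z ^ i)" "poly q z = (\<Sum>i<n. coeff q i * z ^ i)"
      using deg by (auto intro!: poly_eq)
    then show ?thesis
      by (simp only: cnj_sum complex_cnj_mult, simp only: sum_product)
        (simp only: sum_distrib_right, simp only: mult_ac)
  qed
  then show ?thesis
    by (simp only:) (intro Bochner_Integration.integrable_sum integrable_mult_right mono; simp)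
qed

text \<open>A null vector \<open>q\<close> of the semidefinite form lies in its radical:
  \<open>poly q z\<close> vanishes for almost every \<open>z\<close> with \<open>w z > 0\<close>, so
  the integrand against any \<open>p\<close> is null as well.\<close>

lemma weighted_inner_null:
  assumes nn: "\<And>z. 0 \<le> w z"
    and int: "integrable lborel (\<lambda>z. poly q z * cnj (poly q z) * complex_of_real (w z))"
    and 0: "weighted_inner w q q = 0"
  shows "weighted_inner w p q = 0"
proof -
  have eq: "Re (poly q z * cnj (poly q z) * complex_of_real (w z)) = (cmod (poly q z))\<^sup>2 * w z" for z
    by (simp only: complex_norm_square[symmetric] of_real_mult[symmetric] Re_complex_of_real)
  have "integrable lborel (\<lambda>z. (cmod (poly q z))\<^sup>2 * w z)"
    using integrable_Re[OF int] by (simp only: eq)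
  then have "AE z in lborel. (cmod (poly q z))\<^sup>2 * w z = 0"
    using 0 nn by (subst integral_nonneg_eq_0_iff_AE[symmetric]) (auto simp: weighted_inner_self)
  then have "AE z in lborel. poly p z * cnj (poly q z) * complex_of_real (w z) = 0"
    by eventually_elim auto
  then show ?thesis
    unfolding weighted_inner_def by (rule integral_eq_zero_AE)
qed

text \<open>Gram--Schmidt for the possibly degenerate form \<^const>\<open>weighted_inner\<close>: when \<open>q i\<close> is a null
  vector, division by zero sets its coefficient to \<open>0\<close>, which is the right value.\<close>

lemma orthogonal_polynomials:
  assumes w[measurable]: "w \<in> borel_measurable borel" and nn: "\<And>z. 0 \<le> w z"
    and mom: "\<And>i. i < n \<Longrightarrow> integrable lborel (\<lambda>z. cmod z ^ (2 * i) * w z)"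
  shows "\<exists>q. (\<forall>i<n. degree (q i) = i \<and> coeff (q i) i = 1) \<and>
    (\<forall>i<n. \<forall>j<n. i \<noteq> j \<longrightarrow> weighted_inner w (q i) (q j) = 0) \<and>
    (\<forall>i<n. Re (weighted_inner w (q i) (q i)) \<le> (\<integral>z. cmod z ^ (2 * i) * w z \<partial>lborel))"
proof -
  let ?B = "weighted_inner w"
  have int: "integrable lborel (\<lambda>z. poly p z * cnj (poly q z) * complex_of_real (w z))"
    if "\<forall>i\<ge>n. coeff p i = 0" "\<forall>i\<ge>n. coeff q i = 0" for p q
    using that by (intro integrable_weighted_inner[OF w nn mom, of n]) auto
  define good where "good m q \<longleftrightarrow>
    (\<forall>i<m. degree (q i) = i \<and> coeff (q i) i = 1) \<and>
    (\<forall>i<m. \<forall>j<m. i \<noteq> j \<longrightarrow> ?B (q i) (q j) = 0) \<and>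
    (\<forall>i<m. Re (?B (q i) (q i)) \<le> Re (?B (monom 1 i) (monom 1 i)))" for m and q :: "nat \<Rightarrow> complex poly"
  have "\<exists>q. good m q" if "m \<le> n" for m
    using that
  proof (induction m)
    case 0
    then show ?case by (simp add: good_def)
  next
    case (Suc m)
    then obtain q where q: "good m q" by auto
    have m: "m < n" using Suc by simp
    define c where "c i = ?B (monom 1 m) (q i) / ?B (q i) (q i)" for i
    define s where "s = (\<Sum>i<m. Polynomial.smult (c i) (q i))"
    define p where "p = monom 1 m - s"
    have qdeg: "degree (q i) = i" if "i < m" for i using q that by (auto simp: good_def)
    have cq: "coeff (q i) k = 0" if "i < m" "m \<le> k" for i k
      using qdeg that by (auto intro!: coeff_eq_0)
    have cs: "coeff s k = 0" if "m \<le> k" for k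
      using cq that by (simp add: s_def coeff_sum)
    have cp: "coeff p k = 0" if "m < k" for k
      using cs that by (simp add: p_def)
    have "coeff p m = 1" by (simp add: p_def cs)
    then have dp: "degree p = m"
      using cp by (intro antisym degree_le le_degree) auto
    have vq: "\<forall>k\<ge>n. coeff (q i) k = 0" if "i < m" for i
      using cq that m by auto
    have vs: "\<forall>k\<ge>n. coeff s k = 0" using cs m by auto
    have vp: "\<forall>k\<ge>n. coeff p k = 0" using cp m by auto
    have vm: "\<forall>k\<ge>n. coeff (monom (1::complex) m) k = 0" using m by auto
    have ps: "?B p (q j) = 0" if j: "j < m" for j
    proof -
      have "?B s (q j) = (\<Sum>i<m. c i * ?B (q i) (q j))"
        unfolding s_def
        by (intro weighted_inner_sum_left finite_lessThan int[OF _ vq[OF j]]) (simp add: vq)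
      also have "\<dots> = (\<Sum>i<m. if i = j then c j * ?B (q j) (q j) else 0)"
        using q j by (intro sum.cong) (auto simp: good_def)
      also have "\<dots> = c j * ?B (q j) (q j)" using j by simp
      also have "\<dots> = ?B (monom 1 m) (q j)"
      proof (cases "?B (q j) (q j) = 0")
        case True
        then have "?B (monom 1 m) (q j) = 0"
          by (rule weighted_inner_null[where w = w and q = "q j", OF nn int[OF vq[OF j] vq[OF j]]])
        then show ?thesis using True by simp
      qed (simp add: c_def)
      finally have "?B s (q j) = ?B (monom 1 m) (q j)" .
      moreover have "?B p (q j) = ?B (monom 1 m) (q j) - ?B s (q j)"
        by (rule weighted_inner_diff_left[OF int[OF vm vq[OF j]] int[OF vs vq[OF j]], folded p_def])
      ultimately show ?thesis by simp
    qed
    have ps': "?B (q j) p = 0" if "j < m" for j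
      using ps[OF that] weighted_inner_commute[of w "q j" p] by simp
    \<comment> \<open>\<open>s\<close> is a combination of the earlier \<open>q i\<close>, all of
      which are orthogonal to \<open>p\<close>.\<close>
    have "?B s p = (\<Sum>i<m. c i * ?B (q i) p)"
      unfolding s_def
      by (intro weighted_inner_sum_left finite_lessThan int[OF _ vp]) (simp add: vq)
    also have "\<dots> = 0" by (intro sum.neutral) (simp add: ps')
    finally have sp: "?B s p = 0" .
    \<comment> \<open>Pythagoras: as \<open>p\<close> and \<open>s\<close> are orthogonal and add up
      to the monomial, the squared norm of \<open>p\<close> is that of the monomial minus that of
      \<open>s\<close>, hence no larger.\<close>
    have Bpp: "?B p p = ?B (monom 1 m) p - ?B s p"
      by (rule weighted_inner_diff_left[OF int[OF vm vp] int[OF vs vp], folded p_def])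
    have Bms: "?B p s = ?B (monom 1 m) s - ?B s s"
      by (rule weighted_inner_diff_left[OF int[OF vm vs] int[OF vs vs], folded p_def])
    have Bmp: "?B p (monom 1 m) = ?B (monom 1 m) (monom 1 m) - ?B s (monom 1 m)"
      by (rule weighted_inner_diff_left[OF int[OF vm vm] int[OF vs vm], folded p_def])
    have "?B p s = 0" using sp weighted_inner_commute[of w p s] by simp
    then have "?B (monom 1 m) s = ?B s s" using Bms by simp
    moreover have "0 \<le> Re (?B s s)"
      by (simp add: weighted_inner_self nn)
    moreover have "Re (?B (monom 1 m) p) = Re (?B p (monom 1 m))" "Re (?B (monom 1 m) s) = Re (?B s (monom 1 m))"
      using weighted_inner_commute[of w "monom 1 m" p] weighted_inner_commute[of w "monom 1 m" s] by simp_all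
    ultimately have le: "Re (?B p p) \<le> Re (?B (monom 1 m) (monom 1 m))"
      using Bpp Bmp sp by simp
    have "good (Suc m) (q(m := p))"
      using q le dp \<open>coeff p m = 1\<close> ps ps' unfolding good_def less_Suc_eq by simp
    then show ?case by blast
  qed
  then obtain q where q: "good n q" by auto
  have "Re (?B (monom 1 i) (monom 1 i)) = (\<integral>z. cmod z ^ (2 * i) * w z \<partial>lborel)" for i
    by (simp add: weighted_inner_self poly_monom norm_power power_even_eq)
  then show ?thesis
    using q unfolding good_def by auto
qed

text \<open>Hadamard's inequality for the Gram matrix of the monomials, in integrated form.\<close>

lemma integral_vandermonde_le:
  assumes w[measurable]: "w \<in> borel_measurable borel" and nn: "\<And>z. 0 \<le> w z"
    and mom: "\<And>i. i < n \<Longrightarrow> integrable lborel (\<lambda>z. cmod z ^ (2 * i) * w z)"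
  defines "F \<equiv> \<lambda>z::nat \<Rightarrow> complex. (\<Prod>(j, k)\<in>{(j, k). 1 \<le> j \<and> j < k \<and> k \<le> n}. (cmod (z j - z k))\<^sup>2) *
             (\<Prod>j=1..n. w (z j))"
  shows "integrable (\<Pi>\<^sub>M j\<in>{1..n}. lborel) F"
    and "(\<integral>z. F z \<partial>(\<Pi>\<^sub>M j\<in>{1..n}. lborel)) \<le> fact n * (\<Prod>i<n. \<integral>z. cmod z ^ (2 * i) * w z \<partial>lborel)"
proof -
  obtain q where "(\<forall>i<n. degree (q i) = i \<and> coeff (q i) i = 1) \<and>
    (\<forall>i<n. \<forall>j<n. i \<noteq> j \<longrightarrow> weighted_inner w (q i) (q j) = 0) \<and>
    (\<forall>i<n. Re (weighted_inner w (q i) (q i)) \<le> (\<integral>z. cmod z ^ (2 * i) * w z \<partial>lborel))"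
    using orthogonal_polynomials[OF w nn mom, of n] by blast
  then have q: "\<And>i. i < n \<Longrightarrow> degree (q i) = i" "\<And>i. i < n \<Longrightarrow> lead_coeff (q i) = 1"
    "\<And>i j. i < n \<Longrightarrow> j < n \<Longrightarrow> i \<noteq> j \<Longrightarrow> weighted_inner w (q i) (q j) = 0"
    "\<And>i. i < n \<Longrightarrow> Re (weighted_inner w (q i) (q i)) \<le> (\<integral>z. cmod z ^ (2 * i) * w z \<partial>lborel)"
    by auto
  have int: "integrable lborel (\<lambda>z. poly (q i) z * cnj (poly (q j) z) * complex_of_real (w z))"
    if "i < n" "j < n" for i j
    using that by (intro integrable_weighted_inner[OF w nn mom, of n]) (auto simp: q(1) intro!: coeff_eq_0)
  have *: "complex_of_real (\<integral>z. F z \<partial>(\<Pi>\<^sub>M j\<in>{1..n}. lborel)) =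
       fact n * (\<Prod>i<n. weighted_inner w (q i) (q i))"
    unfolding F_def
    by (rule integral_vandermonde_orthogonal(2)[of n q w]) (rule q int; assumption)+
  show "integrable (\<Pi>\<^sub>M j\<in>{1..n}. lborel) F"
    unfolding F_def
    by (rule integral_vandermonde_orthogonal(1)[of n q w]) (rule q int; assumption)+
  have "complex_of_real (\<integral>z. F z \<partial>(\<Pi>\<^sub>M j\<in>{1..n}. lborel)) =
     complex_of_real (fact n * (\<Prod>i<n. Re (weighted_inner w (q i) (q i))))"
    using * by (simp add: weighted_inner_self)
  then have "(\<integral>z. F z \<partial>(\<Pi>\<^sub>M j\<in>{1..n}. lborel)) = fact n * (\<Prod>i<n. Re (weighted_inner w (q i) (q i)))"
    by (simp only: of_real_eq_iff)
  also have "\<dots> \<le> fact n * (\<Prod>i<n. \<integral>z. cmod z ^ (2 * i) * w z \<partial>lborel)"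
    using q(4) by (intro mult_left_mono prod_mono) (auto simp: weighted_inner_self nn)
  finally show "(\<integral>z. F z \<partial>(\<Pi>\<^sub>M j\<in>{1..n}. lborel)) \<le> \<dots>" .
qed

subsection \<open>Polar coordinates\<close>

lemma nn_integral_lborel_complex:
  assumes [measurable]: "f \<in> borel_measurable borel"
  shows "(\<integral>\<^sup>+z. f z \<partial>lborel) = (\<integral>\<^sup>+y. \<integral>\<^sup>+x. f (Complex x y) \<partial>lborel \<partial>lborel)"
proof -
  have [measurable]: "(\<lambda>(x, y). Complex x y) \<in> borel_measurable (borel \<Otimes>\<^sub>M borel)"
    unfolding borel_prod case_prod_unfold Complex_eq
    by (intro borel_measurable_continuous_onI continuous_intros)
  have "lborel = distr (lborel \<Otimes>\<^sub>M lborel) borel (\<lambda>(x, y). Complex x y)"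
  proof (rule lborel_eqI)
    fix l u :: complex assume *: "\<And>b. b \<in> Basis \<Longrightarrow> l \<bullet> b \<le> u \<bullet> b"
    then have le: "Re l \<le> Re u" "Im l \<le> Im u" using *[of 1] *[of \<i>] by (auto simp: Basis_complex_def)
    have "(\<lambda>(x, y). Complex x y) -` box l u = box (Re l) (Re u) \<times> box (Im l) (Im u)"
      by (auto simp: in_box_complex_iff box_real)
    then show "emeasure (distr (lborel \<Otimes>\<^sub>M lborel) borel (\<lambda>(x, y). Complex x y)) (box l u) =
      ennreal (\<Prod>b\<in>Basis. (u - l) \<bullet> b)"
      using le by (simp add: emeasure_distr space_pair_measure lborel.emeasure_pair_measure_Times
          Basis_complex_def ennreal_mult)
  qed simp
  then have "(\<integral>\<^sup>+z. f z \<partial>lborel) =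
      (\<integral>\<^sup>+z. f z \<partial>distr (lborel \<Otimes>\<^sub>M lborel) borel (\<lambda>(x, y). Complex x y))"
    by simp
  also have "\<dots> = (\<integral>\<^sup>+(x, y). f (Complex x y) \<partial>(lborel \<Otimes>\<^sub>M lborel))"
    by (subst nn_integral_distr) (auto simp: case_prod_unfold)
  also have "\<dots> = (\<integral>\<^sup>+y. \<integral>\<^sup>+x. f (Complex x y) \<partial>lborel \<partial>lborel)"
    by (subst lborel_pair.nn_integral_snd[symmetric]) auto
  finally show ?thesis .
qed

lemma nn_integral_lborel_translate:
  fixes f :: "real \<Rightarrow> ennreal"
  assumes [measurable]: "f \<in> borel_measurable borel"
  shows "(\<integral>\<^sup>+x. f (x + t) \<partial>lborel) = (\<integral>\<^sup>+x. f x \<partial>lborel)"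
  using nn_integral_real_affine[OF assms, of 1 t] by (simp add: add.commute)

text \<open>A shear translates one coordinate by an amount that depends only on the other, so
  translation invariance of the inner integral suffices. The vertical shear needs the order of
  integration swapped first.\<close>

lemma nn_integral_lborel_shear:
  fixes f :: "complex \<Rightarrow> ennreal"
  assumes [measurable]: "f \<in> borel_measurable borel"
  shows "(\<integral>\<^sup>+z. f (Complex (Re z + t * Im z) (Im z)) \<partial>lborel) = (\<integral>\<^sup>+z. f z \<partial>lborel)"
    and "(\<integral>\<^sup>+z. f (Complex (Re z) (Im z + t * Re z)) \<partial>lborel) = (\<integral>\<^sup>+z. f z \<partial>lborel)"
proof -
  have [measurable]: "(\<lambda>z. Complex (Re z + t * Im z) (Im z)) \<in> borel_measurable borel"
    "(\<lambda>z. Complex (Re z) (Im z + t * Re z)) \<in> borel_measurable borel"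
    "(\<lambda>x. Complex x y) \<in> borel_measurable borel" "(\<lambda>y. Complex x y) \<in> borel_measurable borel"
    "(\<lambda>(x, y). Complex x y) \<in> borel_measurable (borel \<Otimes>\<^sub>M borel)" for x y
    unfolding borel_prod case_prod_unfold Complex_eq
    by (intro borel_measurable_continuous_onI continuous_intros)+
  show "(\<integral>\<^sup>+z. f (Complex (Re z + t * Im z) (Im z)) \<partial>lborel) = (\<integral>\<^sup>+z. f z \<partial>lborel)"
    by (simp add: nn_integral_lborel_complex nn_integral_lborel_translate[of "\<lambda>x. f (Complex x _)"])
  have sw: "(\<integral>\<^sup>+y. \<integral>\<^sup>+x. g (Complex x y) \<partial>lborel \<partial>lborel) = (\<integral>\<^sup>+x. \<integral>\<^sup>+y. g (Complex x y) \<partial>lborel \<partial>lborel)"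
    if [measurable]: "g \<in> borel_measurable borel" for g :: "complex \<Rightarrow> ennreal"
    by (rule lborel_pair.Fubini') measurable
  show "(\<integral>\<^sup>+z. f (Complex (Re z) (Im z + t * Re z)) \<partial>lborel) = (\<integral>\<^sup>+z. f z \<partial>lborel)"
    by (simp add: nn_integral_lborel_complex)
      (simp add: sw[of f] sw[of "\<lambda>z. f (Complex (Re z) (Im z + t * Re z))", simplified]
        nn_integral_lborel_translate[of "\<lambda>y. f (Complex _ y)"])
qed

text \<open>A rotation that is not a multiple of a half turn is a product of three shears.\<close>

lemma nn_integral_lborel_rotate:
  fixes f :: "complex \<Rightarrow> ennreal"
  assumes [measurable]: "f \<in> borel_measurable borel"
  shows "(\<integral>\<^sup>+z. f (cis \<alpha> * z) \<partial>lborel) = (\<integral>\<^sup>+z. f z \<partial>lborel)"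
proof -
  have *: "(\<integral>\<^sup>+z. f (cis \<alpha> * z) \<partial>lborel) = (\<integral>\<^sup>+z. f z \<partial>lborel)"
    if s: "sin \<alpha> \<noteq> 0" and [measurable]: "f \<in> borel_measurable borel" for \<alpha> and f :: "complex \<Rightarrow> ennreal"
  proof -
    \<comment> \<open>\<open>t = - tan (\<alpha> / 2)\<close>: two horizontal shears by
      \<open>t\<close> around a vertical shear by \<open>sin \<alpha>\<close> compose to the
      rotation.\<close>
    define t where "t = (cos \<alpha> - 1) / sin \<alpha>"
    have [measurable]: "(\<lambda>z. Complex (Re z + t * Im z) (Im z)) \<in> borel_measurable borel"
      "(\<lambda>z. Complex (Re z) (Im z + sin \<alpha> * Re z)) \<in> borel_measurable borel"
      unfolding Complex_eq by (intro borel_measurable_continuous_onI continuous_intros)+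
    define A where "A = (\<lambda>z. Complex (Re z + t * Im z) (Im z))"
    define B where "B = (\<lambda>z. Complex (Re z) (Im z + sin \<alpha> * Re z))"
    have "cis \<alpha> * z = A (B (A z))" for z
    proof (rule complex_eqI)
      have ts: "t * sin \<alpha> = cos \<alpha> - 1" using s by (simp add: t_def)
      have tc: "t * (1 + cos \<alpha>) = - sin \<alpha>"
        using s sin_squared_eq[of \<alpha>] by (simp add: t_def field_simps power2_eq_square)
      show "Im (cis \<alpha> * z) = Im (A (B (A z)))"
        using arg_cong[OF ts, of "\<lambda>u. u * Im z"] by (simp add: A_def B_def cis.sel algebra_simps)
      have "Re (A (B (A z))) = (1 + t * sin \<alpha>) * Re z + (t + t * (1 + t * sin \<alpha>)) * Im z"
        by (simp add: A_def B_def algebra_simps)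
      also have "\<dots> = cos \<alpha> * Re z + (t * (1 + cos \<alpha>)) * Im z"
        unfolding ts by (simp add: algebra_simps)
      finally show "Re (cis \<alpha> * z) = Re (A (B (A z)))" unfolding tc by simp
    qed
    then have "(\<integral>\<^sup>+z. f (cis \<alpha> * z) \<partial>lborel) = (\<integral>\<^sup>+z. (\<lambda>z. f (A (B z))) (A z) \<partial>lborel)" by simp
    also have "\<dots> = (\<integral>\<^sup>+z. (\<lambda>z. f (A z)) (B z) \<partial>lborel)"
      unfolding A_def B_def by (rule nn_integral_lborel_shear) measurable
    also have "\<dots> = (\<integral>\<^sup>+z. f (A z) \<partial>lborel)"
      unfolding A_def B_def by (rule nn_integral_lborel_shear) measurable
    also have "\<dots> = (\<integral>\<^sup>+z. f z \<partial>lborel)"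
      unfolding A_def by (rule nn_integral_lborel_shear) measurable
    finally show ?thesis .
  qed
  show ?thesis
  proof (cases "sin \<alpha> = 0")
    case True
    \<comment> \<open>A multiple of a half turn is split into rotations by
      \<open>\<alpha> + pi / 2\<close> and \<open>- pi / 2\<close>, both of which have nonzero
      sine.\<close>
    have 1: "sin (\<alpha> + pi / 2) \<noteq> 0" "sin (- pi / 2) \<noteq> 0"
      using True sin_zero_abs_cos_one[OF True] by (auto simp: sin_add)
    have "(\<integral>\<^sup>+z. f (cis \<alpha> * z) \<partial>lborel) = (\<integral>\<^sup>+z. (\<lambda>z. f (cis (\<alpha> + pi / 2) * z)) (cis (- pi / 2) * z) \<partial>lborel)"
      by (simp only: mult.assoc[symmetric] cis_mult) simp
    also have "\<dots> = (\<integral>\<^sup>+z. f (cis (\<alpha> + pi / 2) * z) \<partial>lborel)"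
      by (rule *[OF 1(2)]) measurable
    also have "\<dots> = (\<integral>\<^sup>+z. f z \<partial>lborel)"
      by (rule *[OF 1(1)]) measurable
    finally show ?thesis .
  qed (rule *[OF _ assms])
qed

text \<open>Translation moves the window to \<open>{\<alpha>..2*pi+\<alpha>}\<close>; the piece
  beyond a full turn is carried back by periodicity, and changing null endpoints makes the two
  pieces tile \<open>{0..2*pi}\<close> again.\<close>

lemma nn_integral_circle_shift:
  fixes f :: "complex \<Rightarrow> ennreal"
  assumes [measurable]: "f \<in> borel_measurable borel" and \<alpha>: "0 \<le> \<alpha>" "\<alpha> \<le> 2 * pi"
  shows "(\<integral>\<^sup>+\<theta>\<in>{0..2*pi}. f (cis (\<theta> + \<alpha>)) \<partial>lborel) = (\<integral>\<^sup>+\<theta>\<in>{0..2*pi}. f (cis \<theta>) \<partial>lborel)"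
proof -
  have [measurable]: "cis \<in> borel_measurable borel"
    by (intro borel_measurable_continuous_onI continuous_intros)
  have "(\<integral>\<^sup>+\<theta>\<in>{0..2*pi}. f (cis (\<theta> + \<alpha>)) \<partial>lborel) =
      (\<integral>\<^sup>+\<theta>. (\<lambda>\<theta>. f (cis \<theta>) * indicator {\<alpha>..2*pi+\<alpha>} \<theta>) (\<theta> + \<alpha>) \<partial>lborel)"
    by (intro nn_integral_cong) (auto simp: indicator_def)
  also have "\<dots> = (\<integral>\<^sup>+\<theta>\<in>{\<alpha>..2*pi+\<alpha>}. f (cis \<theta>) \<partial>lborel)"
    by (rule nn_integral_lborel_translate) measurable
  also have "\<dots> = (\<integral>\<^sup>+\<theta>\<in>{\<alpha>..2*pi}. f (cis \<theta>) \<partial>lborel) + (\<integral>\<^sup>+\<theta>\<in>{2*pi<..2*pi+\<alpha>}. f (cis \<theta>) \<partial>lborel)"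
    using \<alpha> by (subst nn_integral_add[symmetric])
      (auto intro!: nn_integral_cong simp: indicator_def)
  also have "(\<integral>\<^sup>+\<theta>\<in>{2*pi<..2*pi+\<alpha>}. f (cis \<theta>) \<partial>lborel) =
      (\<integral>\<^sup>+\<theta>. (\<lambda>\<theta>. f (cis \<theta>) * indicator {2*pi<..2*pi+\<alpha>} \<theta>) (\<theta> + 2*pi) \<partial>lborel)"
    by (rule nn_integral_lborel_translate[symmetric]) measurable
  also have "\<dots> = (\<integral>\<^sup>+\<theta>\<in>{0<..\<alpha>}. f (cis \<theta>) \<partial>lborel)"
    by (intro nn_integral_cong) (auto simp: indicator_def cis_mult[symmetric])
  also have "\<dots> = (\<integral>\<^sup>+\<theta>\<in>{0..<\<alpha>}. f (cis \<theta>) \<partial>lborel)"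
    using AE_lborel_singleton[of 0] AE_lborel_singleton[of \<alpha>]
    by (intro nn_integral_cong_AE) (auto simp: indicator_def elim!: eventually_elim2)
  also have "(\<integral>\<^sup>+\<theta>\<in>{\<alpha>..2*pi}. f (cis \<theta>) \<partial>lborel) + \<dots> = (\<integral>\<^sup>+\<theta>\<in>{0..2*pi}. f (cis \<theta>) \<partial>lborel)"
    using \<alpha> by (subst nn_integral_add[symmetric])
      (auto intro!: nn_integral_cong simp: indicator_def)
  finally show ?thesis .
qed

text \<open>Both sides give \<open>{..r}\<close> the area of the disc of radius \<open>r\<close>,
  and \<open>2 * pi * r\<close> is the derivative of that area. Half-lines generate the Borel
  sets.\<close>

lemma distr_lborel_cmod: "distr lborel borel cmod = density lborel (\<lambda>r. ennreal (2 * pi * r) * indicator {0..} r)"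
proof (rule measure_eqI_generator_eq[where \<Omega>=UNIV and E="range (\<lambda>r::real. {..r})" and A="\<lambda>n. {..real n}"])
  show "Int_stable (range (\<lambda>r::real. {..r}))"
    by (auto simp: Int_stable_def)
  have ball: "emeasure (distr lborel borel cmod) {..r} = ennreal (if 0 \<le> r then pi * r\<^sup>2 else 0)" for r
  proof -
    have "cmod -` {..r} = cball 0 r" by auto
    then show ?thesis
      using emeasure_cball[of r "0::complex"]
      by (auto simp: emeasure_distr unit_ball_vol_2)
  qed
  show "emeasure (distr lborel borel cmod) X =
      emeasure (density lborel (\<lambda>r. ennreal (2 * pi * r) * indicator {0..} r)) X"
    if X: "X \<in> range (\<lambda>r::real. {..r})" for X
  proof -
    obtain r where r: "X = {..r}" using X by auto
    have "emeasure (density lborel (\<lambda>r. ennreal (2 * pi * r) * indicator {0..} r)) X =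
      (\<integral>\<^sup>+x. ennreal (2 * pi * x) * indicator {0..r} x \<partial>lborel)"
      unfolding r by (subst emeasure_density) (auto intro!: nn_integral_cong simp: indicator_def)
    also have "\<dots> = ennreal (if 0 \<le> r then pi * r\<^sup>2 else 0)"
    proof (cases "0 \<le> r")
      case True
      have "(\<integral>\<^sup>+x. ennreal (2 * pi * x) * indicator {0..r} x \<partial>lborel) = ennreal (pi * r\<^sup>2 - pi * 0\<^sup>2)"
        using True by (intro nn_integral_FTC_Icc) (auto intro!: derivative_eq_intros)
      then show ?thesis using True by simp
    qed (auto simp: indicator_def intro!: nn_integral_zero')
    finally show ?thesis using ball r by simp
  qed
  show "emeasure (distr lborel borel cmod) {..real n} \<noteq> \<infinity>" for n by (simp add: ball)
  show "(\<Union>n. {..real n}) = UNIV"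
    using real_arch_simple by auto
  show "sets (distr lborel borel cmod) = sigma_sets UNIV (range (\<lambda>r::real. {..r}))"
    by (simp add: borel_eq_atMost)
  show "sets (density lborel (\<lambda>r. ennreal (2 * pi * r) * indicator {0..} r)) = sigma_sets UNIV (range (\<lambda>r::real. {..r}))"
    by (simp add: borel_eq_atMost)
qed auto

text \<open>The rotation-invariant integral is averaged over all rotations. After exchanging the
  integrals, the angular one depends on \<open>z\<close> only through \<open>cmod z\<close>, and the
  law of \<open>cmod\<close> supplies the Jacobian together with a factor \<open>2 * pi\<close> that
  cancels.\<close>

lemma nn_integral_polar:
  fixes f :: "complex \<Rightarrow> ennreal"
  assumes [measurable]: "f \<in> borel_measurable borel"
  shows "(\<integral>\<^sup>+z. f z \<partial>lborel) =
    (\<integral>\<^sup>+r\<in>{0..}. \<integral>\<^sup>+\<theta>\<in>{0..2*pi}. f (rcis r \<theta>) * ennreal r \<partial>lborel \<partial>lborel)"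
proof -
  have [measurable]: "cis \<in> borel_measurable borel"
    by (intro borel_measurable_continuous_onI continuous_intros)
  have [measurable]: "(\<lambda>(r, \<theta>). rcis r \<theta>) \<in> borel_measurable (borel \<Otimes>\<^sub>M borel)"
    unfolding rcis_def by measurable
  define A where "A r = (\<integral>\<^sup>+\<theta>\<in>{0..2*pi}. f (rcis r \<theta>) \<partial>lborel)" for r
  have [measurable]: "A \<in> borel_measurable borel" unfolding A_def by measurable
  have A: "(\<integral>\<^sup>+\<theta>\<in>{0..2*pi}. f (cis \<theta> * z) \<partial>lborel) = A (cmod z)" for z
  proof -
    have "f (cis \<theta> * z) = (\<lambda>u. f (of_real (cmod z) * u)) (cis (\<theta> + Arg2pi z))" for \<theta>
      by (subst Arg2pi_eq[of z]) (simp add: cis_mult[symmetric] mult_ac flip: cis_conv_exp)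
    then have "(\<integral>\<^sup>+\<theta>\<in>{0..2*pi}. f (cis \<theta> * z) \<partial>lborel) =
      (\<integral>\<^sup>+\<theta>\<in>{0..2*pi}. (\<lambda>u. f (of_real (cmod z) * u)) (cis (\<theta> + Arg2pi z)) \<partial>lborel)" by simp
    also have "\<dots> = (\<integral>\<^sup>+\<theta>\<in>{0..2*pi}. (\<lambda>u. f (of_real (cmod z) * u)) (cis \<theta>) \<partial>lborel)"
      using Arg2pi[of z] by (intro nn_integral_circle_shift) auto
    finally show ?thesis by (simp add: A_def rcis_def)
  qed
  have "ennreal (2 * pi) * (\<integral>\<^sup>+z. f z \<partial>lborel) = (\<integral>\<^sup>+\<theta>\<in>{0..2*pi}. (\<integral>\<^sup>+z. f z \<partial>lborel) \<partial>lborel)"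
    by (subst nn_integral_cmult_indicator) (auto simp: mult.commute)
  also have "\<dots> = (\<integral>\<^sup>+\<theta>. \<integral>\<^sup>+z. f (cis \<theta> * z) * indicator {0..2*pi} \<theta> \<partial>lborel \<partial>lborel)"
    by (simp add: nn_integral_multc nn_integral_lborel_rotate)
  also have "\<dots> = (\<integral>\<^sup>+z. \<integral>\<^sup>+\<theta>. f (cis \<theta> * z) * indicator {0..2*pi} \<theta> \<partial>lborel \<partial>lborel)"
    by (rule lborel_pair.Fubini') measurable
  also have "\<dots> = (\<integral>\<^sup>+r. A r \<partial>distr lborel borel cmod)"
    by (simp add: A nn_integral_distr)
  also have "\<dots> = (\<integral>\<^sup>+r. ennreal (2 * pi) * (A r * ennreal r * indicator {0..} r) \<partial>lborel)"
    unfolding distr_lborel_cmod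
    by (subst nn_integral_density) (auto simp: indicator_def ennreal_mult mult_ac intro!: nn_integral_cong)
  also have "\<dots> = ennreal (2 * pi) * (\<integral>\<^sup>+r\<in>{0..}. A r * ennreal r \<partial>lborel)"
    by (subst nn_integral_cmult) auto
  finally have "(\<integral>\<^sup>+z. f z \<partial>lborel) = (\<integral>\<^sup>+r\<in>{0..}. A r * ennreal r \<partial>lborel)"
    by (simp add: ennreal_mult_cancel_left)
  also have "\<dots> = (\<integral>\<^sup>+r\<in>{0..}. \<integral>\<^sup>+\<theta>\<in>{0..2*pi}. f (rcis r \<theta>) * ennreal r \<partial>lborel \<partial>lborel)"
    unfolding A_def by (subst nn_integral_multc[symmetric]) (auto simp: mult_ac)
  finally show ?thesis .
qed

section \<open>Rotation invariance and radial weights\<close>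

lemma distr_lborel_rotate: "distr lborel borel ((*) (cis \<alpha>)) = lborel"
proof (rule measure_eqI)
  fix X assume "X \<in> sets (distr lborel borel ((*) (cis \<alpha>)))"
  then have X[measurable]: "X \<in> sets borel" by simp
  have "emeasure (distr lborel borel ((*) (cis \<alpha>))) X =
      (\<integral>\<^sup>+z. indicator X z \<partial>distr lborel borel ((*) (cis \<alpha>)))"
    by simp
  also have "\<dots> = (\<integral>\<^sup>+z. indicator X (cis \<alpha> * z) \<partial>lborel)"
    by (subst nn_integral_distr) auto
  also have "\<dots> = (\<integral>\<^sup>+z. indicator X z \<partial>lborel)"
    by (rule nn_integral_lborel_rotate) simp
  finally show "emeasure (distr lborel borel ((*) (cis \<alpha>))) X = emeasure lborel X" by simp
qed simp

text \<open>Rotating by \<open>pi / (i - j)\<close> multiplies the integrand by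
  \<open>cis pi = - 1\<close>, so the integral equals its own negative.\<close>

lemma weighted_inner_monom_radial:
  assumes [measurable]: "u \<in> borel_measurable borel" and "i \<noteq> j"
  shows "weighted_inner (\<lambda>z. u (cmod z)) (Polynomial.monom 1 i) (Polynomial.monom 1 j) = 0"
proof -
  define \<alpha> where "\<alpha> = pi / (real i - real j)"
  have "cis (real i * \<alpha>) * cnj (cis (real j * \<alpha>)) = cis ((real i - real j) * \<alpha>)"
    by (simp add: cis_mult cis_cnj algebra_simps)
  also have "(real i - real j) * \<alpha> = pi" using assms(2) by (simp add: \<alpha>_def)
  finally have rot: "cis \<alpha> ^ i * cnj (cis \<alpha> ^ j) = - 1"
    unfolding Complex.DeMoivre cis_pi .
  have [measurable]: "cnj \<in> borel_measurable borel"
    using continuous_on_cnj[OF continuous_on_id] by (rule borel_measurable_continuous_onI)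
  let ?f = "\<lambda>z. z ^ i * cnj (z ^ j) * complex_of_real (u (cmod z))"
  have "(\<integral>z. ?f z \<partial>lborel) = (\<integral>z. ?f z \<partial>distr lborel borel ((*) (cis \<alpha>)))"
    by (simp add: distr_lborel_rotate)
  also have "\<dots> = (\<integral>z. ?f (cis \<alpha> * z) \<partial>lborel)"
    by (rule integral_distr) measurable
  also have "\<dots> = (\<integral>z. (cis \<alpha> ^ i * cnj (cis \<alpha> ^ j)) * ?f z \<partial>lborel)"
    by (intro Bochner_Integration.integral_cong refl)
      (simp add: power_mult_distrib norm_mult mult_ac)
  also have "\<dots> = - (\<integral>z. ?f z \<partial>lborel)"
    unfolding rot by simp
  finally have "(\<integral>z. ?f z \<partial>lborel) = 0" by simp
  then show ?thesis by (simp add: weighted_inner_def poly_monom)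
qed

text \<open>Evaluates the total mass of the unnormalized joint density and thereby fixes its
  constant.\<close>

lemma integral_vandermonde_radial:
  assumes u[measurable]: "u \<in> borel_measurable borel" and nn: "\<And>r. 0 \<le> u r"
    and mom: "\<And>i. i < n \<Longrightarrow> integrable lborel (\<lambda>z. cmod z ^ (2 * i) * u (cmod z))"
  shows "(\<integral>z. (\<Prod>(j, k)\<in>{(j, k). 1 \<le> j \<and> j < k \<and> k \<le> n}. (cmod (z j - z k))\<^sup>2) *
             (\<Prod>j=1..n. u (cmod (z j))) \<partial>(\<Pi>\<^sub>M j\<in>{1..n}. lborel)) =
    fact n * (\<Prod>i<n. \<integral>z. cmod z ^ (2 * i) * u (cmod z) \<partial>lborel)" (is "?I = ?R")
proof -
  let ?q = "\<lambda>i. Polynomial.monom (1::complex) i"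
  have "complex_of_real ?I = fact n * (\<Prod>i<n. weighted_inner (\<lambda>z. u (cmod z)) (?q i) (?q i))"
    by (rule integral_vandermonde_orthogonal)
      (auto simp: degree_monom_eq weighted_inner_monom_radial nn
        intro!: integrable_weighted_inner[of _ n] mom)
  also have "\<dots> = complex_of_real ?R"
    by (simp add: weighted_inner_self poly_monom norm_power power_even_eq)
  finally show ?thesis by (simp only: of_real_eq_iff)
qed

subsection \<open>Testing weak convergence on a countable family\<close>

text \<open>One index \<open>k\<close> controls both the steepness and the mesh of the admissible
  heights, so both become fine together. With centres \<open>d\<close> in a countable dense set the
  family is countable.\<close>

definition tent :: "'a::metric_space \<times> nat \<times> nat \<Rightarrow> 'a \<Rightarrow> real" where
  "tent = (\<lambda>(d, i, k) x. max 0 (real i / real (Suc k) - real k * dist x d))"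

lemma continuous_on_tent: "continuous_on UNIV (tent p)"
  by (cases p) (auto simp: tent_def intro!: continuous_intros)

lemma tent_zero: "tent (d, 0, k) x = 0"
  by (simp add: tent_def)

lemma tent_le: "tent (d, i, k) x \<le> real i / real (Suc k)"
  by (simp add: tent_def)

text \<open>By continuity \<open>f\<close> exceeds \<open>b + e\<close> on a ball around
  \<open>x\<close>. A tent of height just below \<open>b + e\<close> with centre near
  \<open>x\<close> stays under \<open>f\<close>: inside the ball because of its height, outside
  because it is steep enough to have reached 0.\<close>

lemma tent_below:
  fixes f :: "'a::{metric_space, second_countable_topology} \<Rightarrow> real"
  assumes f: "continuous_on UNIV f" and nn: "\<And>x. 0 \<le> f x" and b: "b < f x"
    and D: "\<And>U. open U \<Longrightarrow> U \<noteq> {} \<Longrightarrow> \<exists>d\<in>D. d \<in> (U :: 'a set)"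
  shows "\<exists>d\<in>D. \<exists>i k. b < tent (d, i, k) x \<and> (\<forall>y. tent (d, i, k) y \<le> f y)"
proof (cases "b < 0")
  case True
  obtain d where "d \<in> D" using D[of UNIV] by auto
  then show ?thesis using True nn by (intro bexI[of _ d] exI[of _ 0]) (auto simp: tent_zero)
next
  case False
  define e where "e = (f x - b) / 2"
  have e: "e > 0" "b + e < f x" using b by (auto simp: e_def field_simps)
  have "open {y. b + e < f y}"
    using f by (intro open_Collect_less continuous_on_const) auto
  then obtain r where r: "r > 0" "\<And>y. dist y x < r \<Longrightarrow> b + e < f y"
    using e unfolding open_dist by blast
  \<comment> \<open>The first bound makes the mesh of heights finer than \<open>e / 2\<close>; the
    second makes the tent vanish at distance \<open>r / 2\<close> from its centre.\<close>
  obtain k where k: "real k > max (2 / e) (2 * (b + e) / r)"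
    using reals_Archimedean2 by blast
  have k0: "real k > 0" using k e by (smt (verit) divide_pos_pos)
  define i where "i = nat \<lfloor>(b + e) * real (Suc k)\<rfloor>"
  have "real i = of_int \<lfloor>(b + e) * real (Suc k)\<rfloor>"
    using False e by (simp add: i_def)
  then have i: "real i \<le> (b + e) * real (Suc k)" "(b + e) * real (Suc k) - 1 < real i"
    by linarith+
  have iu: "real i / real (Suc k) \<le> b + e"
    using i(1) by (simp add: divide_le_eq)
  have "e * real k > 2" using k e by (simp add: field_simps)
  then have "1 / real (Suc k) < e / 2"
    using e by (simp add: field_simps)
  moreover have "b + e - 1 / real (Suc k) < real i / real (Suc k)"
    using divide_strict_right_mono[OF i(2), of "real (Suc k)"] by (simp add: diff_divide_distrib)
  ultimately have il: "b + e / 2 < real i / real (Suc k)" by simp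
  \<comment> \<open>\<open>r / 2\<close> keeps points at distance at least \<open>r\<close> from
    \<open>x\<close> at distance at least \<open>r / 2\<close> from \<open>d\<close>;
    \<open>e / (2 * real k)\<close> keeps the drop of the tent at \<open>x\<close> below
    \<open>e / 2\<close>.\<close>
  define \<delta> where "\<delta> = min (r / 2) (e / (2 * real k))"
  have "\<delta> > 0" using r e k0 by (auto simp: \<delta>_def)
  then obtain d where d: "d \<in> D" "dist x d < \<delta>"
    using D[of "ball x \<delta>"] by auto
  have "real k * dist x d < e / 2"
    using d(2) k0 by (simp add: \<delta>_def field_simps)
  then have 1: "b < tent (d, i, k) x"
    using il by (auto simp: tent_def)
  have 2: "tent (d, i, k) y \<le> f y" for y
  proof (cases "dist y x < r")
    case True
    then have "b + e < f y" by (rule r)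
    moreover have "tent (d, i, k) y \<le> max 0 (b + e)"
      using iu by (auto simp: tent_def intro!: max.coboundedI2 order_trans[OF _ iu])
    ultimately show ?thesis using nn[of y] by linarith
  next
    case far: False
    have "dist y x \<le> dist y d + dist x d" by (metis dist_commute dist_triangle)
    then have "dist y d \<ge> r / 2" using far d(2) by (simp add: \<delta>_def)
    then have "real k * dist y d \<ge> real k * (r / 2)" by (intro mult_left_mono) auto
    moreover have "real k * (r / 2) \<ge> b + e" using k r by (simp add: field_simps)
    ultimately have "tent (d, i, k) y = 0" using iu by (simp add: tent_def)
    then show ?thesis using nn by simp
  qed
  show ?thesis using d(1) 1 2 by blast
qed

text \<open>Lists keep the family countable and let maxima grow along an enumeration; the initial
  value 0 gives nonnegativity even for the empty list.\<close>

definition tent_max :: "('a::metric_space \<times> nat \<times> nat) list \<Rightarrow> 'a \<Rightarrow> real" where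
  "tent_max ps x = fold max (map (\<lambda>p. tent p x) ps) 0"

lemma tent_max_simps: "tent_max [] x = 0" "tent_max (ps @ [p]) x = max (tent p x) (tent_max ps x)"
  by (simp_all add: tent_max_def)

lemma continuous_on_tent_max: "continuous_on UNIV (tent_max ps)"
proof (induction ps rule: rev_induct)
  case (snoc p ps)
  then show ?case
    using continuous_on_max[OF continuous_on_tent snoc] by (simp add: tent_max_simps[abs_def])
qed (simp add: tent_max_simps[abs_def])

lemma tent_max_nonneg: "0 \<le> tent_max ps x"
  by (induction ps rule: rev_induct) (auto simp: tent_max_simps)

lemma tent_max_bounded: "\<exists>B. \<forall>x. tent_max ps x \<le> B"
proof (induction ps rule: rev_induct)
  case (snoc p ps)
  then obtain B where "\<forall>x. tent_max ps x \<le> B" by blast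
  moreover obtain d i k where "p = (d, i, k)" by (cases p)
  ultimately have "\<exists>R. \<forall>x. tent p x \<le> R" using tent_le by metis
  then obtain R where "\<forall>x. tent p x \<le> R" by blast
  with \<open>\<forall>x. tent_max ps x \<le> B\<close> have "\<forall>x. tent_max (ps @ [p]) x \<le> max R B"
    unfolding tent_max_simps by (intro allI max.mono) auto
  then show ?case by blast
qed (auto simp: tent_max_simps)

text \<open>Every nonnegative continuous function is the supremum of an increasing sequence in the
  countable family of finite maxima of tents, so weak convergence can be tested on that family.\<close>

lemma weakly_converges_tentI:
  fixes M :: "nat \<Rightarrow> 'a::{metric_space, second_countable_topology} measure"
  assumes prob: "\<And>n. n \<ge> 1 \<Longrightarrow> prob_space (M n)" "prob_space N"
    and sets: "\<And>n. n \<ge> 1 \<Longrightarrow> sets (M n) = sets borel" "sets N = sets borel"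
    and D: "countable D" "\<And>U. open U \<Longrightarrow> U \<noteq> {} \<Longrightarrow> \<exists>d\<in>D. d \<in> (U :: 'a set)"
    and conv: "\<And>ps. ps \<in> lists (D \<times> UNIV) \<Longrightarrow> (\<lambda>n. \<integral>x. tent_max ps x \<partial>M n) \<longlonglongrightarrow> (\<integral>x. tent_max ps x \<partial>N)"
  shows "weakly_converges M N"
proof -
  note bc = borel_measurable_continuous_onI
  have int: "integrable L f" if "prob_space L" "sets L = sets borel" "continuous_on UNIV f"
    "\<And>x. 0 \<le> f x" "\<And>x. f x \<le> B" for L and f :: "'a \<Rightarrow> real" and B
  proof -
    interpret prob_space L by fact
    have "f \<in> borel_measurable L" using bc[OF that(3)] measurable_cong_sets[OF that(2) refl] by blast
    then show ?thesis using that(4,5) by (intro integrable_const_bound[of _ B]) auto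
  qed
  \<comment> \<open>Only a bound from below is proved, by approximating \<open>f\<close> from below.
    Applied to both \<open>f + B\<close> and \<open>B - f\<close> it yields convergence.\<close>
  have lower: "\<forall>\<^sub>F n in sequentially. (\<integral>x. f x \<partial>N) - e < (\<integral>x. f x \<partial>M n)"
    if f: "continuous_on UNIV f" "\<And>x. 0 \<le> f x" "\<And>x. f x \<le> B" and e: "e > 0" for f :: "'a \<Rightarrow> real" and B e
  proof -
    define T where "T = {p \<in> D \<times> UNIV. \<forall>y. tent p y \<le> f y}"
    have "countable T" unfolding T_def using D(1) by (auto intro: countable_subset[of _ "D \<times> UNIV"])
    \<comment> \<open>The zero tent makes \<open>T\<close> nonempty, which is what lets
      \<open>from_nat_into\<close> enumerate exactly \<open>T\<close>.\<close>
    moreover obtain d where "d \<in> D" using D(2)[of UNIV] by auto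
    then have "(d, 0, 0) \<in> T" using f(2) by (auto simp: T_def tent_zero)
    then have "T \<noteq> {}" by auto
    ultimately have T: "range (from_nat_into T) = T" by (simp add: range_from_nat_into)
    define s where "s m = tent_max (map (from_nat_into T) [0..<m])" for m
    have s_Suc: "s (Suc m) x = max (tent (from_nat_into T m) x) (s m x)" for m x
      by (simp add: s_def tent_max_simps)
    have sf: "s m x \<le> f x" for m x
    proof (induction m)
      case (Suc m)
      have "from_nat_into T m \<in> T" using T by blast
      then show ?case using Suc by (auto simp: s_Suc T_def)
    qed (simp add: s_def tent_max_simps f)
    have mono: "incseq (\<lambda>m. s m x)" for x
      by (rule incseq_SucI) (simp add: s_Suc)
    have lim: "(\<lambda>m. s m x) \<longlonglongrightarrow> f x" for x
    proof (rule increasing_tendsto)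
      show "\<forall>\<^sub>F m in sequentially. s m x \<le> f x" using sf by simp
      fix b assume "b < f x"
      then obtain d i k where d: "d \<in> D" "b < tent (d, i, k) x" "\<forall>y. tent (d, i, k) y \<le> f y"
        using tent_below[OF f(1,2) _ D(2)] by blast
      then have "(d, i, k) \<in> T" by (simp add: T_def)
      then obtain m where m: "from_nat_into T m = (d, i, k)" using T by (metis imageE)
      have "b < s n x" if "n \<ge> Suc m" for n
        using incseqD[OF mono that, of x] d(2) by (simp add: s_Suc m)
      then show "\<forall>\<^sub>F m in sequentially. b < s m x"
        unfolding eventually_sequentially by blast
    qed
    have contf: "continuous_on UNIV (s m)" for m unfolding s_def by (rule continuous_on_tent_max)
    have s0: "0 \<le> s m x" for m x unfolding s_def by (rule tent_max_nonneg)
    have sB: "s m x \<le> B" for m x using sf f(3) order_trans by blast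
    have meas: "g \<in> borel_measurable N" if "continuous_on UNIV g" for g :: "'a \<Rightarrow> real"
      using bc[OF that] measurable_cong_sets[OF sets(2) refl] by blast
    interpret N: prob_space N by fact
    have "(\<lambda>m. \<integral>x. s m x \<partial>N) \<longlonglongrightarrow> (\<integral>x. f x \<partial>N)"
      by (rule integral_dominated_convergence[where w="\<lambda>_. B"])
        (use lim s0 sB meas f contf in auto)
    then have "\<forall>\<^sub>F m in sequentially. (\<integral>x. f x \<partial>N) - e / 2 < (\<integral>x. s m x \<partial>N)"
      using e by (intro order_tendstoD) auto
    then obtain m where m: "(\<integral>x. f x \<partial>N) - e / 2 < (\<integral>x. s m x \<partial>N)"
      by (auto simp: eventually_sequentially)
    have "map (from_nat_into T) [0..<m] \<in> lists (D \<times> UNIV)"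
    proof -
      have "from_nat_into T j \<in> T" for j using T by blast
      then have "from_nat_into T j \<in> D \<times> UNIV" for j unfolding T_def by blast
      then show ?thesis by (simp add: in_lists_conv_set)
    qed
    then have "(\<lambda>n. \<integral>x. s m x \<partial>M n) \<longlonglongrightarrow> (\<integral>x. s m x \<partial>N)" unfolding s_def by (rule conv)
    then have "\<forall>\<^sub>F n in sequentially. (\<integral>x. f x \<partial>N) - e < (\<integral>x. s m x \<partial>M n)"
      using m e by (intro order_tendstoD) auto
    with eventually_ge_at_top[of 1] show ?thesis
    proof eventually_elim
      case (elim n)
      have "(\<integral>x. s m x \<partial>M n) \<le> (\<integral>x. f x \<partial>M n)"
        using elim by (intro integral_mono int[of _ _ B] prob sets contf f s0 sB sf)
      then show ?case using elim by simp
    qed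
  qed
  show ?thesis unfolding weakly_converges_def
  proof (intro allI impI)
    fix f :: "'a \<Rightarrow> real" assume "continuous_on UNIV f \<and> bounded (range f)"
    then obtain B where f: "continuous_on UNIV f" and B: "\<And>x. \<bar>f x\<bar> \<le> B"
      by (auto simp: bounded_iff)
    define g where "g x = f x + B" for x
    define h where "h x = B - f x" for x
    have g: "continuous_on UNIV g" "0 \<le> g x" "g x \<le> 2 * B" for x
      using f B[of x] by (auto simp: g_def intro!: continuous_intros)
    have h: "continuous_on UNIV h" "0 \<le> h x" "h x \<le> 2 * B" for x
      using f B[of x] by (auto simp: h_def intro!: continuous_intros)
    have Ig: "(\<integral>x. f x \<partial>L) = (\<integral>x. g x \<partial>L) - B" and Ih: "(\<integral>x. f x \<partial>L) = B - (\<integral>x. h x \<partial>L)"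
      if "prob_space L" "sets L = sets borel" for L
    proof -
      interpret prob_space L by fact
      have g_int: "integrable L g"
        using that g by (intro int)
      have "integrable L (\<lambda>x. g x - B)"
        by (intro Bochner_Integration.integrable_diff g_int) simp
      then have "integrable L f" by (simp add: g_def)
      then show "(\<integral>x. f x \<partial>L) = (\<integral>x. g x \<partial>L) - B" "(\<integral>x. f x \<partial>L) = B - (\<integral>x. h x \<partial>L)"
        unfolding g_def h_def by (simp_all add: prob_space)
    qed
    show "(\<lambda>n. \<integral>x. f x \<partial>M n) \<longlonglongrightarrow> (\<integral>x. f x \<partial>N)"
    proof (rule tendstoI)
      fix e :: real assume e: "e > 0"
      show "\<forall>\<^sub>F n in sequentially. dist (\<integral>x. f x \<partial>M n) (\<integral>x. f x \<partial>N) < e"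
        using lower[OF g e] lower[OF h e] eventually_ge_at_top[of 1]
      proof eventually_elim
        case (elim n)
        then show ?case
          using Ig[OF prob(1) sets(1), of n] Ih[OF prob(1) sets(1), of n]
            Ig[OF prob(2) sets(2)] Ih[OF prob(2) sets(2)]
          by (simp add: dist_real_def abs_less_iff)
      qed
    qed
  qed
qed

lemma weakly_converges_distr:
  fixes M :: "nat \<Rightarrow> 'a::topological_space measure" and g :: "'a \<Rightarrow> 'b::topological_space"
  assumes "weakly_converges M N" and g: "continuous_on UNIV g"
    and sets: "\<And>n. sets (M n) = sets borel" "sets N = sets borel"
  shows "weakly_converges (\<lambda>n. distr (M n) borel g) (distr N borel g)"
  unfolding weakly_converges_def
proof (intro allI impI)
  fix f :: "'b \<Rightarrow> real" assume f: "continuous_on UNIV f \<and> bounded (range f)"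
  have D: "(\<integral>x. f x \<partial>distr L borel g) = (\<integral>x. f (g x) \<partial>L)" if "sets L = sets borel" for L
    using f borel_measurable_continuous_onI[OF g] measurable_cong_sets[OF that refl, of borel]
    by (intro integral_distr) (auto intro: borel_measurable_continuous_onI)
  have "continuous_on UNIV (\<lambda>x. f (g x)) \<and> bounded (range (\<lambda>x. f (g x)))"
    using f g by (auto intro: continuous_on_compose2[of UNIV f] elim: bounded_subset)
  then show "(\<lambda>n. \<integral>x. f x \<partial>distr (M n) borel g) \<longlonglongrightarrow> (\<integral>x. f x \<partial>distr N borel g)"
    using assms(1) unfolding weakly_converges_def D[OF sets(1)] D[OF sets(2)] by blast
qed

subsection \<open>Concentration of linear statistics\<close>

text \<open>Tilting every point by \<open>exp (g z)\<close> keeps the Vandermonde form and only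
  replaces the weight, so the Hadamard bound applies to the tilted weight. The \<open>a i\<close>
  normalize the planar laws with weights \<open>cmod z ^ (2 * i) * u (cmod z)\<close>.\<close>

lemma radial_ensemble_exp_moment:
  fixes u :: "real \<Rightarrow> real" and Z :: "nat \<Rightarrow> 'a \<Rightarrow> complex" and g :: "complex \<Rightarrow> real"
  assumes P: "prob_space P"
    and u[measurable]: "u \<in> borel_measurable borel" and nn: "\<And>r. 0 \<le> u r"
    and Z: "density_proportional_to P (\<Pi>\<^sub>M j\<in>{1..n}. lborel) (\<lambda>\<omega>. \<lambda>j\<in>{1..n}. Z j \<omega>)
        (\<lambda>z. (\<Prod>(j, k)\<in>{(j, k). 1 \<le> j \<and> j < k \<and> k \<le> n}. (cmod (z j - z k))\<^sup>2) *
             (\<Prod>j=1..n. u (cmod (z j))))"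
    and a: "\<And>i. i < n \<Longrightarrow> a i > 0"
    and N: "\<And>i. i < n \<Longrightarrow> prob_space (density lborel (\<lambda>z. ennreal (a i * (cmod z ^ (2 * i) * u (cmod z)))))"
    and g[measurable]: "g \<in> borel_measurable borel" and B: "\<And>z. \<bar>g z\<bar> \<le> B"
  shows "(\<integral>\<^sup>+\<omega>. ennreal (exp (\<Sum>j=1..n. g (Z j \<omega>))) \<partial>P) \<le>
    (\<Prod>i<n. \<integral>\<^sup>+z. ennreal (exp (g z)) \<partial>density lborel (\<lambda>z. ennreal (a i * (cmod z ^ (2 * i) * u (cmod z)))))"
proof -
  interpret prob_space P by fact
  let ?L = "\<Pi>\<^sub>M j\<in>{1..n}. (lborel :: complex measure)"
  define V where "V = (\<lambda>z::nat \<Rightarrow> complex. \<Prod>(j, k)\<in>{(j, k). 1 \<le> j \<and> j < k \<and> k \<le> n}. (cmod (z j - z k))\<^sup>2)"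
  define w where "w z = exp (g z) * u (cmod z)" for z
  have V0: "0 \<le> V z" for z unfolding V_def by (intro prod_nonneg) auto
  have [measurable]: "w \<in> borel_measurable borel" unfolding w_def by measurable
  have w0: "0 \<le> w z" for z unfolding w_def using nn by simp
  obtain c where c: "c > 0" and dist: "distributed P ?L (\<lambda>\<omega>. \<lambda>j\<in>{1..n}. Z j \<omega>)
      (\<lambda>z. ennreal (c * (V z * (\<Prod>j=1..n. u (cmod (z j))))))"
    using Z unfolding density_proportional_to_def V_def by auto
  have mu1: "(\<integral>\<^sup>+z. ennreal (a i * (cmod z ^ (2 * i) * u (cmod z))) \<partial>lborel) = 1" if "i < n" for i
    using prob_space.emeasure_space_1[OF N[OF that]] by (simp add: emeasure_density)
  have mom: "integrable lborel (\<lambda>z. cmod z ^ (2 * i) * u (cmod z))" if "i < n" for i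
  proof -
    have "integrable lborel (\<lambda>z. a i * (cmod z ^ (2 * i) * u (cmod z)))"
      using mu1[OF that] a[OF that] nn by (intro integrableI_nonneg) auto
    then show ?thesis using a[OF that] by simp
  qed
  have kappa: "a i * (\<integral>z. cmod z ^ (2 * i) * u (cmod z) \<partial>lborel) = 1" if "i < n" for i
  proof -
    have "(\<integral>z. a i * (cmod z ^ (2 * i) * u (cmod z)) \<partial>lborel) = 1"
      using mu1[OF that] a[OF that] nn by (subst integral_eq_nn_integral) auto
    then show ?thesis by simp
  qed
  have momw: "integrable lborel (\<lambda>z. cmod z ^ (2 * i) * w z)" if "i < n" for i
  proof (rule Bochner_Integration.integrable_bound)
    show "integrable lborel (\<lambda>z. exp B * (cmod z ^ (2 * i) * u (cmod z)))"
      using mom[OF that] by simp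
    have "exp (g z) \<le> exp B" for z using B[of z] by simp
    then show "AE z in lborel. norm (cmod z ^ (2 * i) * w z) \<le> norm (exp B * (cmod z ^ (2 * i) * u (cmod z)))"
      using nn by (intro always_eventually allI)
        (auto simp: w_def abs_mult mult.left_commute intro!: mult_left_mono mult_right_mono)
  qed measurable
  have K: "c * (fact n * (\<Prod>i<n. \<integral>z. cmod z ^ (2 * i) * u (cmod z) \<partial>lborel)) = 1"
  proof -
    have int: "integrable ?L (\<lambda>z. V z * (\<Prod>j=1..n. u (cmod (z j))))"
      unfolding V_def using nn mom by (intro integral_vandermonde_le(1)) auto
    have "1 = (\<integral>\<^sup>+z. ennreal (c * (V z * (\<Prod>j=1..n. u (cmod (z j))))) \<partial>?L)"
      using distributed_nn_integral[OF dist, of "\<lambda>_. 1"] by (simp add: emeasure_space_1)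
    also have "\<dots> = ennreal (\<integral>z. c * (V z * (\<Prod>j=1..n. u (cmod (z j)))) \<partial>?L)"
      using c V0 nn int by (intro nn_integral_eq_integral) (auto intro!: AE_I2 mult_nonneg_nonneg prod_nonneg)
    finally have "ennreal (\<integral>z. c * (V z * (\<Prod>j=1..n. u (cmod (z j)))) \<partial>?L) = 1"
      by (rule sym)
    then have "c * (\<integral>z. V z * (\<Prod>j=1..n. u (cmod (z j))) \<partial>?L) = 1"
      by (simp only: ennreal_eq_1 integral_mult_right_zero)
    then show ?thesis
      unfolding V_def by (subst (asm) integral_vandermonde_radial) (use nn mom in auto)
  qed
  \<comment> \<open>The normalizer of the joint density is exactly the product of the
    \<open>a i\<close> divided by \<open>fact n\<close>, so the comparison carries no extra
    constant.\<close>
  have cn: "c * fact n = (\<Prod>i<n. a i)"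
  proof -
    have "(\<Prod>i<n. a i * (\<integral>z. cmod z ^ (2 * i) * u (cmod z) \<partial>lborel)) = 1"
      using kappa by simp
    then have "(\<Prod>i<n. a i) * (\<Prod>i<n. \<integral>z. cmod z ^ (2 * i) * u (cmod z) \<partial>lborel) = 1"
      by (simp only: prod.distrib)
    moreover have "x = y" if "x * k = 1" "y * k = 1" for x y k :: real
      using that by (metis mult_cancel_right mult_zero_right zero_neq_one)
    ultimately show ?thesis using K[folded mult.assoc] by blast
  qed
  have gm: "(\<lambda>z. ennreal (exp (\<Sum>j=1..n. g (z j)))) \<in> borel_measurable ?L"
  proof -
    have gl: "g \<in> borel_measurable lborel" by simp
    have "(\<lambda>z. g (z j)) \<in> borel_measurable ?L" if "j \<in> {1..n}" for j
      by (rule measurable_compose[OF measurable_component_singleton[OF that] gl])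
    then show ?thesis
      by (intro measurable_compose[OF _ measurable_ennreal] measurable_compose[OF _ borel_measurable_exp]
          borel_measurable_sum)
  qed
  have "(\<integral>\<^sup>+\<omega>. ennreal (exp (\<Sum>j=1..n. g (Z j \<omega>))) \<partial>P) =
     (\<integral>\<^sup>+\<omega>. (\<lambda>z. ennreal (exp (\<Sum>j=1..n. g (z j)))) (\<lambda>j\<in>{1..n}. Z j \<omega>) \<partial>P)"
    by (intro nn_integral_cong) (auto intro!: arg_cong[where f=exp] sum.cong)
  also have "\<dots> = (\<integral>\<^sup>+z. ennreal (c * (V z * (\<Prod>j=1..n. u (cmod (z j))))) * ennreal (exp (\<Sum>j=1..n. g (z j))) \<partial>?L)"
    by (rule distributed_nn_integral[OF dist gm, symmetric])
  also have "\<dots> = (\<integral>\<^sup>+z. ennreal (c * (V z * (\<Prod>j=1..n. w (z j)))) \<partial>?L)"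
  proof (intro nn_integral_cong)
    fix z :: "nat \<Rightarrow> complex"
    have eq: "c * (V z * (\<Prod>j=1..n. w (z j))) =
       c * (V z * (\<Prod>j=1..n. u (cmod (z j)))) * exp (\<Sum>j=1..n. g (z j))"
      by (simp add: w_def prod.distrib exp_sum)
    show "ennreal (c * (V z * (\<Prod>j=1..n. u (cmod (z j))))) * ennreal (exp (\<Sum>j=1..n. g (z j))) =
       ennreal (c * (V z * (\<Prod>j=1..n. w (z j))))"
      unfolding eq by (rule ennreal_mult''[symmetric]) simp
  qed
  also have "\<dots> = ennreal (\<integral>z. c * (V z * (\<Prod>j=1..n. w (z j))) \<partial>?L)"
  proof (rule nn_integral_eq_integral)
    show "integrable ?L (\<lambda>z. c * (V z * (\<Prod>j=1..n. w (z j))))"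
      unfolding V_def using w0 momw by (intro integrable_mult_right integral_vandermonde_le(1)) auto
    show "AE z in ?L. 0 \<le> c * (V z * (\<Prod>j=1..n. w (z j)))"
      using c V0 w0 by (auto intro!: AE_I2 mult_nonneg_nonneg prod_nonneg)
  qed
  also have "\<dots> = ennreal (c * (\<integral>z. V z * (\<Prod>j=1..n. w (z j)) \<partial>?L))" by simp
  also have "\<dots> \<le> ennreal (c * (fact n * (\<Prod>i<n. \<integral>z. cmod z ^ (2 * i) * w z \<partial>lborel)))"
    unfolding V_def using c w0 momw
    by (intro ennreal_leI mult_left_mono integral_vandermonde_le(2)) auto
  also have "c * (fact n * (\<Prod>i<n. \<integral>z. cmod z ^ (2 * i) * w z \<partial>lborel)) =
      (\<Prod>i<n. a i * (\<integral>z. cmod z ^ (2 * i) * w z \<partial>lborel))"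
    unfolding mult.assoc[symmetric] cn by (simp only: prod.distrib)
  also have "ennreal \<dots> = (\<Prod>i<n. ennreal (a i * (\<integral>z. cmod z ^ (2 * i) * w z \<partial>lborel)))"
    using a w0 by (intro prod_ennreal[symmetric] mult_nonneg_nonneg integral_nonneg) (auto intro: less_imp_le)
  also have "\<dots> = (\<Prod>i<n. \<integral>\<^sup>+z. ennreal (exp (g z)) \<partial>density lborel (\<lambda>z. ennreal (a i * (cmod z ^ (2 * i) * u (cmod z)))))"
  proof (intro prod.cong refl)
    fix i assume "i \<in> {..<n}"
    then have i: "i < n" by simp
    have "(\<integral>\<^sup>+z. ennreal (exp (g z)) \<partial>density lborel (\<lambda>z. ennreal (a i * (cmod z ^ (2 * i) * u (cmod z))))) =
      (\<integral>\<^sup>+z. ennreal (a i * (cmod z ^ (2 * i) * w z)) \<partial>lborel)"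
      using a[OF i] nn by (subst nn_integral_density)
        (auto simp: w_def mult_ac intro!: nn_integral_cong simp flip: ennreal_mult)
    also have "\<dots> = ennreal (\<integral>z. a i * (cmod z ^ (2 * i) * w z) \<partial>lborel)"
      using a[OF i] momw[OF i] w0 by (intro nn_integral_eq_integral) auto
    finally show "ennreal (a i * (\<integral>z. cmod z ^ (2 * i) * w z \<partial>lborel)) =
       (\<integral>\<^sup>+z. ennreal (exp (g z)) \<partial>density lborel (\<lambda>z. ennreal (a i * (cmod z ^ (2 * i) * u (cmod z)))))"
      by simp
  qed
  finally show ?thesis .
qed

text \<open>A Chernoff bound. For values in an interval of length \<open>2 * B\<close>, Hoeffding's
  lemma bounds each centred factor by \<open>exp (t\<^sup>2 * B\<^sup>2 / 2)\<close>.\<close>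

lemma radial_ensemble_upper_tail:
  fixes u :: "real \<Rightarrow> real" and Z :: "nat \<Rightarrow> 'a \<Rightarrow> complex" and g :: "complex \<Rightarrow> real"
  assumes P: "prob_space P" and n: "n \<ge> 1"
    and u[measurable]: "u \<in> borel_measurable borel" and nn: "\<And>r. 0 \<le> u r"
    and Z: "density_proportional_to P (\<Pi>\<^sub>M j\<in>{1..n}. lborel) (\<lambda>\<omega>. \<lambda>j\<in>{1..n}. Z j \<omega>)
        (\<lambda>z. (\<Prod>(j, k)\<in>{(j, k). 1 \<le> j \<and> j < k \<and> k \<le> n}. (cmod (z j - z k))\<^sup>2) *
             (\<Prod>j=1..n. u (cmod (z j))))"
    and Zm[measurable]: "\<And>j. j \<in> {1..n} \<Longrightarrow> Z j \<in> borel_measurable P"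
    and a: "\<And>i. i < n \<Longrightarrow> a i > 0"
    and N: "\<And>i. i < n \<Longrightarrow> prob_space (density lborel (\<lambda>z. ennreal (a i * (cmod z ^ (2 * i) * u (cmod z)))))"
    and g[measurable]: "g \<in> borel_measurable borel" and B: "\<And>z. \<bar>g z\<bar> \<le> B" "B > 0" and e: "e > 0"
  defines "m \<equiv> \<lambda>i. \<integral>z. g z \<partial>density lborel (\<lambda>z. ennreal (a i * (cmod z ^ (2 * i) * u (cmod z))))"
  shows "measure P {\<omega> \<in> space P. (\<Sum>j=1..n. g (Z j \<omega>)) - (\<Sum>i<n. m i) \<ge> real n * e} \<le>
    exp (- (real n * e\<^sup>2 / (2 * B\<^sup>2)))"
proof -
  interpret prob_space P by fact
  \<comment> \<open>This \<open>t\<close> minimizes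
    \<open>t\<^sup>2 * B\<^sup>2 / 2 - t * e\<close>, with minimum
    \<open>- e\<^sup>2 / (2 * B\<^sup>2)\<close>.\<close>
  define t where "t = e / B\<^sup>2"
  have t: "t > 0" using e B by (simp add: t_def)
  let ?N = "\<lambda>i. density lborel (\<lambda>z. ennreal (a i * (cmod z ^ (2 * i) * u (cmod z))))"
  let ?S = "\<lambda>\<omega>. \<Sum>j=1..n. g (Z j \<omega>)"
  define A where "A = {\<omega> \<in> space P. ?S \<omega> - (\<Sum>i<n. m i) \<ge> real n * e}"
  have [measurable]: "A \<in> sets P" unfolding A_def by measurable
  have single: "(\<integral>\<^sup>+z. ennreal (exp (t * g z)) \<partial>?N i) \<le> ennreal (exp (t * m i + t\<^sup>2 * B\<^sup>2 / 2))" if "i < n" for i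
  proof -
    interpret N: prob_space "?N i" using N[OF that] .
    interpret N: interval_bounded_random_variable "?N i" g "- B" B
      by standard (use B(1) in \<open>auto simp: abs_le_iff minus_le_iff\<close>)
    have "(\<integral>\<^sup>+z. ennreal (exp (t * g z)) \<partial>?N i) =
       (\<integral>\<^sup>+z. ennreal (exp (t * m i)) * ennreal (exp (t * (g z - m i))) \<partial>?N i)"
      by (intro nn_integral_cong) (simp add: algebra_simps flip: ennreal_mult exp_add)
    also have "\<dots> = ennreal (exp (t * m i)) * (\<integral>\<^sup>+z. ennreal (exp (t * (g z - m i))) \<partial>?N i)"
      by (rule nn_integral_cmult) measurable
    also have "\<dots> \<le> ennreal (exp (t * m i)) * ennreal (exp (t\<^sup>2 * B\<^sup>2 / 2))"
      using N.Hoeffdings_lemma_nn_integral[OF t]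
      by (intro mult_left_mono) (simp_all add: m_def power2_eq_square mult_ac)
    finally show ?thesis by (simp add: exp_add ennreal_mult)
  qed
  have "(\<integral>\<^sup>+\<omega>. ennreal (exp (t * ?S \<omega>)) \<partial>P) = (\<integral>\<^sup>+\<omega>. ennreal (exp (\<Sum>j=1..n. t * g (Z j \<omega>))) \<partial>P)"
    by (simp add: sum_distrib_left)
  also have "\<dots> \<le> (\<Prod>i<n. \<integral>\<^sup>+z. ennreal (exp (t * g z)) \<partial>?N i)"
    using t B(1) by (intro radial_ensemble_exp_moment[OF P u nn Z a N, where B="t * B"])
      (auto simp: abs_mult)
  also have "\<dots> \<le> (\<Prod>i<n. ennreal (exp (t * m i + t\<^sup>2 * B\<^sup>2 / 2)))"
    using single by (intro prod_mono_ennreal) auto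
  also have "\<dots> = ennreal (exp (\<Sum>i<n. t * m i + t\<^sup>2 * B\<^sup>2 / 2))"
    by (simp add: prod_ennreal exp_sum)
  also have "(\<Sum>i<n. t * m i + t\<^sup>2 * B\<^sup>2 / 2) = t * (\<Sum>i<n. m i) + real n * (t\<^sup>2 * B\<^sup>2 / 2)"
    by (simp add: sum.distrib sum_distrib_left)
  finally have mgf: "(\<integral>\<^sup>+\<omega>. ennreal (exp (t * ?S \<omega>)) \<partial>P) \<le>
      ennreal (exp (t * (\<Sum>i<n. m i) + real n * (t\<^sup>2 * B\<^sup>2 / 2)))" .
  define K where "K = t * (\<Sum>i<n. m i) + t * (real n * e)"
  have "emeasure P A = (\<integral>\<^sup>+\<omega>. indicator A \<omega> \<partial>P)" by simp
  also have "\<dots> \<le> (\<integral>\<^sup>+\<omega>. ennreal (exp (- K)) * ennreal (exp (t * ?S \<omega>)) \<partial>P)"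
  proof (intro nn_integral_mono)
    fix \<omega>
    show "indicator A \<omega> \<le> ennreal (exp (- K)) * ennreal (exp (t * ?S \<omega>))"
    proof (cases "\<omega> \<in> A")
      case True
      then have "(\<Sum>i<n. m i) + real n * e \<le> ?S \<omega>" by (simp add: A_def)
      then have "t * ((\<Sum>i<n. m i) + real n * e) \<le> t * ?S \<omega>" using t by (intro mult_left_mono) auto
      then have "1 \<le> exp (- K + t * ?S \<omega>)" by (simp add: K_def algebra_simps)
      then have "ennreal 1 \<le> ennreal (exp (- K) * exp (t * ?S \<omega>))"
        unfolding exp_add by (rule ennreal_leI)
      then show ?thesis using True by (simp only: ennreal_mult exp_ge_zero) simp
    qed auto
  qed
  also have "\<dots> = ennreal (exp (- K)) * (\<integral>\<^sup>+\<omega>. ennreal (exp (t * ?S \<omega>)) \<partial>P)"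
    by (rule nn_integral_cmult) measurable
  also have "\<dots> \<le> ennreal (exp (- K)) * ennreal (exp (t * (\<Sum>i<n. m i) + real n * (t\<^sup>2 * B\<^sup>2 / 2)))"
    using mgf by (rule mult_left_mono) simp
  also have "\<dots> = ennreal (exp (- K + (t * (\<Sum>i<n. m i) + real n * (t\<^sup>2 * B\<^sup>2 / 2))))"
    by (simp only: ennreal_mult[symmetric] exp_ge_zero mult_exp_exp)
  also have "- K + (t * (\<Sum>i<n. m i) + real n * (t\<^sup>2 * B\<^sup>2 / 2)) = - (real n * e\<^sup>2 / (2 * B\<^sup>2))"
    using B(2) by (simp add: K_def t_def field_simps power2_eq_square)
  finally show ?thesis
    unfolding A_def[symmetric] by (simp add: emeasure_eq_measure)
qed

text \<open>The upper tail is applied to \<open>g\<close> and to \<open>- g\<close>. The bound is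
  written as a power so that it is visibly geometric in \<open>n\<close>.\<close>

lemma radial_ensemble_concentration:
  fixes u :: "real \<Rightarrow> real" and Z :: "nat \<Rightarrow> 'a \<Rightarrow> complex" and g :: "complex \<Rightarrow> real"
  assumes P: "prob_space P" and n: "n \<ge> 1"
    and u[measurable]: "u \<in> borel_measurable borel" and nn: "\<And>r. 0 \<le> u r"
    and Z: "density_proportional_to P (\<Pi>\<^sub>M j\<in>{1..n}. lborel) (\<lambda>\<omega>. \<lambda>j\<in>{1..n}. Z j \<omega>)
        (\<lambda>z. (\<Prod>(j, k)\<in>{(j, k). 1 \<le> j \<and> j < k \<and> k \<le> n}. (cmod (z j - z k))\<^sup>2) *
             (\<Prod>j=1..n. u (cmod (z j))))"
    and Zm[measurable]: "\<And>j. j \<in> {1..n} \<Longrightarrow> Z j \<in> borel_measurable P"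
    and a: "\<And>i. i < n \<Longrightarrow> a i > 0"
    and N: "\<And>i. i < n \<Longrightarrow> prob_space (density lborel (\<lambda>z. ennreal (a i * (cmod z ^ (2 * i) * u (cmod z)))))"
    and g[measurable]: "g \<in> borel_measurable borel" and B: "\<And>z. \<bar>g z\<bar> \<le> B" "B > 0" and e: "e > 0"
  defines "m \<equiv> \<lambda>i. \<integral>z. g z \<partial>density lborel (\<lambda>z. ennreal (a i * (cmod z ^ (2 * i) * u (cmod z))))"
  shows "measure P {\<omega> \<in> space P. \<bar>(\<Sum>j=1..n. g (Z j \<omega>)) / real n - (\<Sum>i<n. m i) / real n\<bar> \<ge> e} \<le>
    2 * exp (- (e\<^sup>2 / (2 * B\<^sup>2))) ^ n"
proof -
  interpret prob_space P by fact
  let ?S = "\<lambda>\<omega>. \<Sum>j=1..n. g (Z j \<omega>)"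
  let ?A = "{\<omega> \<in> space P. ?S \<omega> - (\<Sum>i<n. m i) \<ge> real n * e}"
  let ?A' = "{\<omega> \<in> space P. (\<Sum>j=1..n. - g (Z j \<omega>)) - (\<Sum>i<n. - m i) \<ge> real n * e}"
  have "{\<omega> \<in> space P. \<bar>?S \<omega> / real n - (\<Sum>i<n. m i) / real n\<bar> \<ge> e} \<subseteq> ?A \<union> ?A'"
  proof
    fix \<omega> assume "\<omega> \<in> {\<omega> \<in> space P. \<bar>?S \<omega> / real n - (\<Sum>i<n. m i) / real n\<bar> \<ge> e}"
    then have \<omega>: "\<omega> \<in> space P" and "e \<le> \<bar>?S \<omega> - (\<Sum>i<n. m i)\<bar> / real n"
      by (auto simp: diff_divide_distrib[symmetric])
    then have "real n * e \<le> \<bar>?S \<omega> - (\<Sum>i<n. m i)\<bar>"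
      using n by (simp add: pos_le_divide_eq mult.commute)
    then show "\<omega> \<in> ?A \<union> ?A'" using \<omega> by (auto simp: sum_negf abs_if split: if_splits)
  qed
  then have "measure P {\<omega> \<in> space P. \<bar>?S \<omega> / real n - (\<Sum>i<n. m i) / real n\<bar> \<ge> e} \<le> measure P (?A \<union> ?A')"
    by (intro finite_measure_mono) measurable
  also have "\<dots> \<le> measure P ?A + measure P ?A'"
    by (rule measure_Un_le) measurable
  also have "\<dots> \<le> exp (- (real n * e\<^sup>2 / (2 * B\<^sup>2))) + exp (- (real n * e\<^sup>2 / (2 * B\<^sup>2)))"
  proof (rule add_mono)
    show "measure P ?A \<le> exp (- (real n * e\<^sup>2 / (2 * B\<^sup>2)))"
      unfolding m_def by (rule radial_ensemble_upper_tail[OF P n u nn Z Zm a N g B e])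
    have "- m i = (\<integral>z. - g z \<partial>density lborel (\<lambda>z. ennreal (a i * (cmod z ^ (2 * i) * u (cmod z)))))" for i
      by (simp add: m_def)
    then show "measure P ?A' \<le> exp (- (real n * e\<^sup>2 / (2 * B\<^sup>2)))"
      by (simp only:) (rule radial_ensemble_upper_tail[OF P n u nn Z Zm a N _ _ B(2) e]; simp add: B(1))
  qed
  finally show ?thesis by (simp add: exp_of_nat_mult[symmetric])
qed

text \<open>Borel--Cantelli for each threshold \<open>e\<close>, followed by a countable
  intersection over \<open>e = 1 / (m + 1)\<close>.\<close>

lemma (in prob_space) AE_tendsto_zero_geometric:
  fixes X :: "nat \<Rightarrow> 'a \<Rightarrow> real"
  assumes [measurable]: "\<And>n. n \<ge> 1 \<Longrightarrow> X n \<in> borel_measurable M"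
    and tail: "\<And>e. e > 0 \<Longrightarrow> \<exists>q C. 0 \<le> q \<and> q < 1 \<and> (\<forall>n\<ge>1. prob {\<omega> \<in> space M. \<bar>X n \<omega>\<bar> \<ge> e} \<le> C * q ^ n)"
  shows "AE \<omega> in M. (\<lambda>n. X n \<omega>) \<longlonglongrightarrow> 0"
proof -
  have "AE \<omega> in M. \<forall>\<^sub>F n in sequentially. \<bar>X n \<omega>\<bar> < e" if e: "e > 0" for e
  proof -
    obtain q C where q: "0 \<le> q" "q < 1" and C: "\<And>n. n \<ge> 1 \<Longrightarrow> prob {\<omega> \<in> space M. \<bar>X n \<omega>\<bar> \<ge> e} \<le> C * q ^ n"
      using tail[OF e] by blast
    \<comment> \<open>The shift to \<open>Suc n\<close> confines the events to indices at which the
      tail bound is assumed.\<close>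
    define A where "A n = {\<omega> \<in> space M. \<bar>X (Suc n) \<omega>\<bar> \<ge> e}" for n
    have [measurable]: "A n \<in> sets M" for n unfolding A_def by measurable
    have "summable (\<lambda>n. C * q ^ Suc n)"
      using q summable_geometric[of q] by (intro summable_mult) (simp add: summable_mult)
    moreover have "norm (prob (A k)) \<le> C * q ^ Suc k" for k
      using C[of "Suc k"] by (simp add: A_def)
    ultimately have "summable (\<lambda>n. prob (A n))"
      by (rule summable_comparison_test')
    then have "AE \<omega> in M. \<forall>\<^sub>F n in sequentially. \<omega> \<in> space M - A n"
      by (intro borel_cantelli_AE1) (auto simp: less_top[symmetric])
    then show ?thesis
    proof eventually_elim
      case (elim \<omega>)
      then have "\<forall>\<^sub>F n in sequentially. \<bar>X (Suc n) \<omega>\<bar> < e"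
        by eventually_elim (auto simp: A_def)
      then show ?case by (rule eventually_sequentially_Suc[THEN iffD1])
    qed
  qed
  then have "AE \<omega> in M. \<forall>m. \<forall>\<^sub>F n in sequentially. \<bar>X n \<omega>\<bar> < inverse (real (Suc m))"
    by (subst AE_all_countable) auto
  then show ?thesis
  proof eventually_elim
    case (elim \<omega>)
    show ?case
    proof (rule tendstoI)
      fix e :: real assume "e > 0"
      then obtain m where "inverse (real (Suc m)) < e" using reals_Archimedean by blast
      then show "\<forall>\<^sub>F n in sequentially. dist (X n \<omega>) 0 < e"
        using elim[rule_format, of m] by (auto elim!: eventually_mono)
    qed
  qed
qed

subsection \<open>Convergence of the empirical measures\<close>

abbreviation (input) unif_angle :: "real measure" where
  "unif_angle \<equiv> uniform_measure lborel {0..2 * pi}"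

section \<open>Planar laws with uniform angle and radius \<open>Y\<close>\<close>

lemma prob_space_unif_angle: "prob_space unif_angle"
  by (rule prob_space_uniform_measure) auto

text \<open>Reconciles the closed interval of the uniform law with the half-open range of
  \<open>Arg2pi\<close>.\<close>

lemma AE_unif_angle: "AE \<theta> in unif_angle. 0 \<le> \<theta> \<and> \<theta> < 2 * pi"
proof (rule AE_uniform_measureI)
  show "AE \<theta> in lborel. \<theta> \<in> {0..2 * pi} \<longrightarrow> 0 \<le> \<theta> \<and> \<theta> < 2 * pi"
    using AE_lborel_singleton[of "2 * pi"] by eventually_elim auto
qed simp

text \<open>\<open>Arg2pi\<close> jumps across the positive real axis, yet its sublevel sets are
  closed.\<close>

lemma borel_measurable_Arg2pi [measurable]: "Arg2pi \<in> borel_measurable borel"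
  unfolding borel_measurable_iff_le
  using borel_closed[OF closed_Arg2pi2pi_le] by simp

text \<open>The Jacobian turns \<open>r ^ (2 * i)\<close> into the power in the density of
  \<open>Y\<close>. The planar law is therefore that of \<open>rcis Y \<theta>\<close> with
  \<open>\<theta>\<close> uniform and independent, expressed by an iterated integral so that
  \<open>\<theta>\<close> need not live on \<open>P\<close>.\<close>

lemma radial_measure_polar:
  fixes Y :: "'a \<Rightarrow> real"
  assumes P: "prob_space P" and [measurable]: "u \<in> borel_measurable borel"
    and Y: "density_proportional_to P lborel Y (\<lambda>y. y ^ (2 * Suc i - 1) * \<phi> y * indicator {0..} y)"
    and u: "\<And>y. 0 \<le> y \<Longrightarrow> u y = \<phi> y" "\<And>y. 0 \<le> u y"
  shows "\<exists>a>0. \<forall>f\<in>borel_measurable borel.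
    (\<integral>\<^sup>+z. f z \<partial>density lborel (\<lambda>z. ennreal (a * (cmod z ^ (2 * i) * u (cmod z))))) =
    (\<integral>\<^sup>+\<omega>. \<integral>\<^sup>+\<theta>. f (rcis (Y \<omega>) \<theta>) \<partial>unif_angle \<partial>P)"
proof -
  obtain c where c: "c > 0" and dist: "distributed P lborel Y
      (\<lambda>y. ennreal (c * (y ^ (2 * Suc i - 1) * \<phi> y * indicator {0..} y)))"
    using Y by (auto simp: density_proportional_to_def)
  \<comment> \<open>The factor \<open>2 * pi\<close> is the Lebesgue mass of the angles, which the
    uniform law divides out.\<close>
  define a where "a = c / (2 * pi)"
  have a: "a > 0" using c by (simp add: a_def)
  have "(\<integral>\<^sup>+z. f z \<partial>density lborel (\<lambda>z. ennreal (a * (cmod z ^ (2 * i) * u (cmod z))))) =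
    (\<integral>\<^sup>+\<omega>. \<integral>\<^sup>+\<theta>. f (rcis (Y \<omega>) \<theta>) \<partial>unif_angle \<partial>P)"
    if [measurable]: "f \<in> borel_measurable borel" for f
  proof -
    have [measurable]: "cis \<in> borel_measurable borel"
      by (intro borel_measurable_continuous_onI continuous_intros)
    have [measurable]: "(\<lambda>(r, \<theta>). rcis r \<theta>) \<in> borel_measurable (borel \<Otimes>\<^sub>M borel)"
      unfolding rcis_def by measurable
    define G where "G r = (\<integral>\<^sup>+\<theta>\<in>{0..2*pi}. f (rcis r \<theta>) \<partial>lborel)" for r
    have [measurable]: "G \<in> borel_measurable borel" unfolding G_def by measurable
    have G: "(\<integral>\<^sup>+\<theta>. f (rcis r \<theta>) \<partial>unif_angle) = G r / ennreal (2 * pi)" for r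
      by (subst nn_integral_uniform_measure) (auto simp: G_def)
    have "(\<integral>\<^sup>+z. f z \<partial>density lborel (\<lambda>z. ennreal (a * (cmod z ^ (2 * i) * u (cmod z))))) =
      (\<integral>\<^sup>+z. ennreal (a * (cmod z ^ (2 * i) * u (cmod z))) * f z \<partial>lborel)"
      by (subst nn_integral_density) auto
    also have "\<dots> = (\<integral>\<^sup>+r\<in>{0..}. \<integral>\<^sup>+\<theta>\<in>{0..2*pi}. ennreal (a * (\<bar>r\<bar> ^ (2 * i) * u \<bar>r\<bar>)) * f (rcis r \<theta>) * ennreal r \<partial>lborel \<partial>lborel)"
      by (subst nn_integral_polar) auto
    also have "\<dots> = (\<integral>\<^sup>+r. ennreal (c * (r ^ (2 * Suc i - 1) * \<phi> r * indicator {0..} r)) * (G r / ennreal (2 * pi)) \<partial>lborel)"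
    proof (intro nn_integral_cong)
      fix r :: real
      show "(\<integral>\<^sup>+\<theta>\<in>{0..2*pi}. ennreal (a * (\<bar>r\<bar> ^ (2 * i) * u \<bar>r\<bar>)) * f (rcis r \<theta>) * ennreal r \<partial>lborel) * indicator {0..} r =
        ennreal (c * (r ^ (2 * Suc i - 1) * \<phi> r * indicator {0..} r)) * (G r / ennreal (2 * pi))"
      proof (cases "0 \<le> r")
        case True
        have "(\<integral>\<^sup>+\<theta>\<in>{0..2*pi}. ennreal (a * (\<bar>r\<bar> ^ (2 * i) * u \<bar>r\<bar>)) * f (rcis r \<theta>) * ennreal r \<partial>lborel) =
          (\<integral>\<^sup>+\<theta>. ennreal (a * (r ^ (2 * i) * u r) * r) * (f (rcis r \<theta>) * indicator {0..2*pi} \<theta>) \<partial>lborel)"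
          using True a u(2)[of r] by (intro nn_integral_cong) (simp add: ennreal_mult' mult_ac)
        also have "\<dots> = ennreal (a * (r ^ (2 * i) * u r) * r) * G r"
          unfolding G_def by (rule nn_integral_cmult) measurable
        also have "a * (r ^ (2 * i) * u r) * r = c * (r ^ (2 * Suc i - 1) * \<phi> r) * inverse (2 * pi)"
          using True u(1)[of r] by (simp add: a_def field_simps)
        also have "ennreal \<dots> = ennreal (c * (r ^ (2 * Suc i - 1) * \<phi> r)) * inverse (ennreal (2 * pi))"
          by (subst ennreal_mult'') (auto simp: inverse_ennreal)
        finally show ?thesis using True by (simp add: divide_ennreal_def mult_ac)
      qed simp
    qed
    also have "\<dots> = (\<integral>\<^sup>+\<omega>. G (Y \<omega>) / ennreal (2 * pi) \<partial>P)"
      by (rule distributed_nn_integral[OF dist]) measurable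
    finally show ?thesis by (simp add: G)
  qed
  then show ?thesis using a by blast
qed

text \<open>At radius 0 the angle cannot be recovered from the point; this excludes that case almost
  surely.\<close>

lemma AE_pos_of_density:
  fixes Y :: "'a \<Rightarrow> real"
  assumes "density_proportional_to P lborel Y (\<lambda>y. f y * indicator {0..} y)"
  shows "AE \<omega> in P. 0 < Y \<omega>"
proof -
  obtain c where dist: "distributed P lborel Y (\<lambda>y. ennreal (c * (f y * indicator {0..} y)))"
    using assms by (auto simp: density_proportional_to_def)
  have "AE y in lborel. 0 < ennreal (c * (f y * indicator {0..} y)) \<longrightarrow> 0 < y"
    using AE_lborel_singleton[of "0::real"]
    by eventually_elim (auto simp: indicator_def split: if_splits)
  then have "AE y in density lborel (\<lambda>y. ennreal (c * (f y * indicator {0..} y))). 0 < y"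
    using distributed_borel_measurable[OF dist] by (subst AE_density) auto
  then have "AE y in distr P lborel Y. 0 < y"
    by (simp only: distributed_distr_eq_density[OF dist])
  then show ?thesis
    by (subst (asm) AE_distr_iff) (use distributed_measurable[OF dist] in auto)
qed

section \<open>From linear statistics to weak convergence\<close>

lemma integral_empirical_measure:
  fixes f :: "'b::topological_space \<Rightarrow> real"
  assumes "f \<in> borel_measurable borel"
  shows "(\<integral>x. f x \<partial>empirical_measure n y) = (\<Sum>j=1..n. f (y j)) / real n"
  unfolding empirical_measure_def
  using assms by (simp add: integral_distr measurable_uniform_count_measure integral_uniform_count_measure)

lemma distr_empirical_measure:
  assumes "g \<in> borel_measurable borel"
  shows "distr (empirical_measure n y) borel g = empirical_measure n (\<lambda>j. g (y j))"
  unfolding empirical_measure_def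
  using assms by (simp add: distr_distr measurable_uniform_count_measure comp_def)

text \<open>Makes the angular average of a test function admissible as a test function for the
  radial empirical measures.\<close>

lemma continuous_on_integral_snd:
  fixes s :: "real \<times> real \<Rightarrow> real"
  assumes "prob_space M" and M: "sets M = sets borel"
    and s: "continuous_on UNIV s" "\<And>x. \<bar>s x\<bar> \<le> B"
  shows "continuous_on UNIV (\<lambda>r. \<integral>\<theta>. s (\<theta>, r) \<partial>M)"
  unfolding continuous_on_sequentially comp_def
proof (intro ballI allI impI)
  interpret prob_space M by fact
  fix X :: "nat \<Rightarrow> real" and r assume "(\<forall>n. X n \<in> UNIV) \<and> X \<longlonglongrightarrow> r"
  then have X: "X \<longlonglongrightarrow> r" by simp
  have [measurable]: "(\<lambda>\<theta>. s (\<theta>, r)) \<in> borel_measurable M" for r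
    unfolding measurable_cong_sets[OF M refl]
    by (intro borel_measurable_continuous_onI continuous_on_compose2[OF s(1)] continuous_intros) auto
  show "(\<lambda>n. \<integral>\<theta>. s (\<theta>, X n) \<partial>M) \<longlonglongrightarrow> (\<integral>\<theta>. s (\<theta>, r) \<partial>M)"
  proof (rule integral_dominated_convergence[where w="\<lambda>_. B"])
    have "(\<lambda>n. s (\<theta>, X n)) \<longlonglongrightarrow> s (\<theta>, r)" for \<theta>
      using s(1) by (intro continuous_on_tendsto_compose[of UNIV s] tendsto_Pair tendsto_const X) auto
    then show "AE \<theta> in M. (\<lambda>n. s (\<theta>, X n)) \<longlonglongrightarrow> s (\<theta>, r)" by simp
  qed (use s in auto)
qed

text \<open>Identifies the centring constants. For positive radius and angle in the half-open range,
  \<open>Arg2pi\<close> returns the angle itself, so only its average at level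
  \<open>H (Y \<omega>)\<close> remains.\<close>

lemma radial_measure_integral:
  fixes Y :: "'a \<Rightarrow> real" and s :: "real \<times> real \<Rightarrow> real" and H :: "real \<Rightarrow> real"
  assumes P: "prob_space P" and [measurable]: "Y \<in> borel_measurable P" "H \<in> borel_measurable borel"
    and pos: "AE \<omega> in P. 0 < Y \<omega>"
    and polar: "\<And>f. f \<in> borel_measurable borel \<Longrightarrow>
      (\<integral>\<^sup>+z. f z \<partial>N) = (\<integral>\<^sup>+\<omega>. \<integral>\<^sup>+\<theta>. f (rcis (Y \<omega>) \<theta>) \<partial>unif_angle \<partial>P)"
    and N: "sets N = sets borel"
    and s: "continuous_on UNIV s" "\<And>x. 0 \<le> s x" "\<And>x. s x \<le> B"
  shows "(\<integral>z. s (Arg2pi z, H (cmod z)) \<partial>N) = (\<integral>\<omega>. \<integral>\<theta>. s (\<theta>, H (Y \<omega>)) \<partial>unif_angle \<partial>P)"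
proof -
  interpret U: prob_space unif_angle by (rule prob_space_unif_angle)
  have [measurable]: "s \<in> borel_measurable borel" using s(1) by (rule borel_measurable_continuous_onI)
  then have [measurable]: "s \<in> borel_measurable (borel \<Otimes>\<^sub>M borel)" by (simp add: borel_prod)
  let ?g = "\<lambda>z. s (Arg2pi z, H (cmod z))"
  let ?S = "\<lambda>r. \<integral>\<theta>. s (\<theta>, r) \<partial>unif_angle"
  have [measurable]: "?g \<in> borel_measurable borel" by measurable
  have [measurable]: "?g \<in> borel_measurable N" unfolding measurable_cong_sets[OF N refl] by measurable
  have [measurable]: "?S \<in> borel_measurable borel"
    using s by (intro borel_measurable_continuous_onI continuous_on_integral_snd[where B=B] prob_space_unif_angle)
      (auto simp: abs_of_nonneg)
  have S0: "0 \<le> ?S r" for r using s by (intro Bochner_Integration.integral_nonneg) auto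
  have inner: "(\<integral>\<^sup>+\<theta>. ennreal (?g (rcis y \<theta>)) \<partial>unif_angle) = ennreal (?S (H y))" if "y > 0" for y
  proof -
    have "(\<integral>\<^sup>+\<theta>. ennreal (?g (rcis y \<theta>)) \<partial>unif_angle) = (\<integral>\<^sup>+\<theta>. ennreal (s (\<theta>, H y)) \<partial>unif_angle)"
    proof (rule nn_integral_cong_AE)
      show "AE \<theta> in unif_angle. ennreal (?g (rcis y \<theta>)) = ennreal (s (\<theta>, H y))"
        using AE_unif_angle
      proof eventually_elim
        case (elim \<theta>)
        have "Arg2pi (rcis y \<theta>) = \<theta>"
          using that elim by (intro Arg2pi_unique[of y]) (auto simp: rcis_def cis_conv_exp)
        then show ?case using that by simp
      qed
    qed
    also have "\<dots> = ennreal (?S (H y))"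
      using s by (intro nn_integral_eq_integral U.integrable_const_bound[where B=B]) (auto simp: abs_of_nonneg)
    finally show ?thesis .
  qed
  have "(\<integral>z. ?g z \<partial>N) = enn2real (\<integral>\<^sup>+z. ennreal (?g z) \<partial>N)"
    using s by (intro integral_eq_nn_integral) auto
  also have "(\<integral>\<^sup>+z. ennreal (?g z) \<partial>N) = (\<integral>\<^sup>+\<omega>. \<integral>\<^sup>+\<theta>. ennreal (?g (rcis (Y \<omega>) \<theta>)) \<partial>unif_angle \<partial>P)"
    by (rule polar) measurable
  also have "\<dots> = (\<integral>\<^sup>+\<omega>. ennreal (?S (H (Y \<omega>))) \<partial>P)"
  proof (rule nn_integral_cong_AE)
    show "AE \<omega> in P. (\<integral>\<^sup>+\<theta>. ennreal (?g (rcis (Y \<omega>) \<theta>)) \<partial>unif_angle) = ennreal (?S (H (Y \<omega>)))"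
      using pos by eventually_elim (rule inner)
  qed
  also have "enn2real \<dots> = (\<integral>\<omega>. ?S (H (Y \<omega>)) \<partial>P)"
    using S0 by (intro integral_eq_nn_integral[symmetric]) auto
  finally show ?thesis .
qed

lemma empirical_polar_as_convergence:
  fixes P :: "'a measure"
    and \<phi> :: "nat \<Rightarrow> real \<Rightarrow> real"
    and Z :: "nat \<Rightarrow> nat \<Rightarrow> 'a \<Rightarrow> complex"
    and Y :: "nat \<Rightarrow> nat \<Rightarrow> 'a \<Rightarrow> real"
    and h :: "nat \<Rightarrow> real \<Rightarrow> real"
  assumes P: "prob_space P"
    and \<phi>: "\<And>n. n \<ge> 1 \<Longrightarrow> \<phi> n \<in> borel_measurable (restrict_space borel {0..})"
      "\<And>n x. n \<ge> 1 \<Longrightarrow> x \<ge> 0 \<Longrightarrow> \<phi> n x \<ge> 0"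
    and Z: "\<And>n. n \<ge> 1 \<Longrightarrow>
      density_proportional_to P (\<Pi>\<^sub>M j\<in>{1..n}. lborel) (\<lambda>\<omega>. \<lambda>j\<in>{1..n}. Z n j \<omega>)
        (\<lambda>z. (\<Prod>(j, k)\<in>{(j, k). 1 \<le> j \<and> j < k \<and> k \<le> n}. (cmod (z j - z k))\<^sup>2) *
             (\<Prod>j=1..n. \<phi> n (cmod (z j))))"
    and Y: "\<And>n j. 1 \<le> j \<Longrightarrow> j \<le> n \<Longrightarrow>
      density_proportional_to P lborel (Y n j)
        (\<lambda>y. y ^ (2 * j - 1) * \<phi> n y * indicator {0..} y)"
    and h: "\<And>n. n \<ge> 1 \<Longrightarrow> h n \<in> borel_measurable (restrict_space borel {0..})"
    and \<nu>: "real_distribution \<nu>"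
    and conv: "as_weakly_converges P (\<lambda>n \<omega>. empirical_measure n (\<lambda>j. h n (Y n j \<omega>))) \<nu>"
  shows "as_weakly_converges P
    (\<lambda>n \<omega>. empirical_measure n (\<lambda>j. (Arg2pi (Z n j \<omega>), h n (cmod (Z n j \<omega>)))))
    (unif_angle \<Otimes>\<^sub>M \<nu>)"
proof -
  interpret P: prob_space P by fact
  interpret U: prob_space unif_angle by (rule prob_space_unif_angle)
  interpret V: real_distribution \<nu> by fact
  interpret UV: pair_prob_space unif_angle \<nu> ..
  \<comment> \<open>Even extensions of \<open>\<phi> n\<close> and \<open>h n\<close> to the whole
    line are Borel there and agree with the originals at every modulus.\<close>
  define u where "u n y = \<phi> n \<bar>y\<bar>" for n y
  define H where "H n y = h n \<bar>y\<bar>" for n y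
  have abs_meas: "abs \<in> measurable borel (restrict_space borel {0::real..})"
    by (rule measurable_restrict_space2) auto
  have u[measurable]: "u n \<in> borel_measurable borel" if "n \<ge> 1" for n
    using measurable_compose[OF abs_meas \<phi>(1)[OF that]] by (simp add: u_def[abs_def])
  have H[measurable]: "H n \<in> borel_measurable borel" if "n \<ge> 1" for n
    using measurable_compose[OF abs_meas h[OF that]] by (simp add: H_def[abs_def])
  have u0: "0 \<le> u n y" if "n \<ge> 1" for n y using \<phi>(2)[OF that] by (simp add: u_def)
  have Zu: "density_proportional_to P (\<Pi>\<^sub>M j\<in>{1..n}. lborel) (\<lambda>\<omega>. \<lambda>j\<in>{1..n}. Z n j \<omega>)
        (\<lambda>z. (\<Prod>(j, k)\<in>{(j, k). 1 \<le> j \<and> j < k \<and> k \<le> n}. (cmod (z j - z k))\<^sup>2) *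
             (\<Prod>j=1..n. u n (cmod (z j))))" if "n \<ge> 1" for n
    using Z[OF that] by (simp add: u_def)
  have Zm: "Z n j \<in> borel_measurable P" if "n \<ge> 1" "j \<in> {1..n}" for n j
  proof -
    have "(\<lambda>\<omega>. \<lambda>j\<in>{1..n}. Z n j \<omega>) \<in> measurable P (\<Pi>\<^sub>M j\<in>{1..n}. lborel)"
      using Z[OF that(1)] by (auto simp: density_proportional_to_def dest: distributed_measurable)
    from measurable_compose[OF this measurable_component_singleton[OF that(2)]] that(2)
    show ?thesis by simp
  qed
  have Ym: "Y n j \<in> borel_measurable P" if "j \<in> {1..n}" for n j
    using Y[of j n] that by (auto simp: density_proportional_to_def dest: distributed_measurable)
  have Ypos: "AE \<omega> in P. 0 < Y n j \<omega>" if "j \<in> {1..n}" for n j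
    using Y[of j n] that by (intro AE_pos_of_density) auto
  define Q where "Q n i a \<longleftrightarrow> a > 0 \<and> (\<forall>f\<in>borel_measurable borel.
      (\<integral>\<^sup>+z. f z \<partial>density lborel (\<lambda>z. ennreal (a * (cmod z ^ (2 * i) * u n (cmod z))))) =
      (\<integral>\<^sup>+\<omega>. \<integral>\<^sup>+\<theta>. f (rcis (Y n (Suc i) \<omega>) \<theta>) \<partial>unif_angle \<partial>P))" for n i and a :: real
  have "\<exists>a. Q n i a" if n: "n \<ge> 1" and i: "i < n" for n i
  proof -
    have "\<exists>a>0. \<forall>f\<in>borel_measurable borel.
      (\<integral>\<^sup>+z. f z \<partial>density lborel (\<lambda>z. ennreal (a * (cmod z ^ (2 * i) * u n (cmod z))))) =
      (\<integral>\<^sup>+\<omega>. \<integral>\<^sup>+\<theta>. f (rcis (Y n (Suc i) \<omega>) \<theta>) \<partial>unif_angle \<partial>P)"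
      using i by (intro radial_measure_polar[where \<phi> = "\<phi> n", OF P u[OF n] Y _ u0[OF n]]) (auto simp: u_def)
    then show ?thesis unfolding Q_def by blast
  qed
  then obtain a where Q: "\<And>n i. n \<ge> 1 \<Longrightarrow> i < n \<Longrightarrow> Q n i (a n i)" by metis
  have a: "a n i > 0" if "n \<ge> 1" "i < n" for n i
    using Q[OF that] unfolding Q_def by blast
  have polar: "(\<integral>\<^sup>+z. f z \<partial>density lborel (\<lambda>z. ennreal (a n i * (cmod z ^ (2 * i) * u n (cmod z))))) =
      (\<integral>\<^sup>+\<omega>. \<integral>\<^sup>+\<theta>. f (rcis (Y n (Suc i) \<omega>) \<theta>) \<partial>unif_angle \<partial>P)"
    if "n \<ge> 1" "i < n" "f \<in> borel_measurable borel" for n i f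
    using Q[OF that(1,2)] that(3) unfolding Q_def by blast
  let ?N = "\<lambda>n i. density lborel (\<lambda>z. ennreal (a n i * (cmod z ^ (2 * i) * u n (cmod z))))"
  have N: "prob_space (?N n i)" if "n \<ge> 1" "i < n" for n i
    using polar[OF that, of "\<lambda>_. 1"] U.emeasure_space_1 P.emeasure_space_1 by (intro prob_spaceI) simp
  have single: "AE \<omega> in P. (\<lambda>n. \<integral>x. s x \<partial>empirical_measure n (\<lambda>j. (Arg2pi (Z n j \<omega>), h n (cmod (Z n j \<omega>)))))
      \<longlonglongrightarrow> (\<integral>x. s x \<partial>(unif_angle \<Otimes>\<^sub>M \<nu>))"
    if s: "continuous_on UNIV s" "\<And>x. 0 \<le> s x" "\<And>x. s x \<le> B" and B: "B > 0" for s :: "real \<times> real \<Rightarrow> real" and B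
  proof -
    have sb: "\<bar>s x\<bar> \<le> B" for x using s(2,3)[of x] by simp
    have [measurable]: "s \<in> borel_measurable borel" using s(1) by (rule borel_measurable_continuous_onI)
    then have [measurable]: "s \<in> borel_measurable (borel \<Otimes>\<^sub>M borel)" by (simp add: borel_prod)
    define S where "S r = (\<integral>\<theta>. s (\<theta>, r) \<partial>unif_angle)" for r
    have Sc: "continuous_on UNIV S"
      unfolding S_def[abs_def] by (rule continuous_on_integral_snd[OF prob_space_unif_angle _ s(1) sb]) simp
    then have [measurable]: "S \<in> borel_measurable borel" by (rule borel_measurable_continuous_onI)
    have Sb: "\<bar>S r\<bar> \<le> B" for r
    proof -
      have "0 \<le> S r" unfolding S_def using s by (intro Bochner_Integration.integral_nonneg) auto
      moreover have "S r \<le> (\<integral>\<theta>. B \<partial>unif_angle)" unfolding S_def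
        using sb s(3) B by (intro integral_mono U.integrable_const_bound[where B=B]) auto
      ultimately show ?thesis by (simp add: U.prob_space)
    qed
    define g where "g n z = s (Arg2pi z, H n (cmod z))" for n z
    have g[measurable]: "g n \<in> borel_measurable borel" if "n \<ge> 1" for n
      using H[OF that] unfolding g_def[abs_def] by measurable
    define m where "m n i = (\<integral>z. g n z \<partial>?N n i)" for n i
    \<comment> \<open>\<open>W n\<close> is almost surely the integral of \<open>S\<close> against
      the empirical measure of the \<open>h n (Y n j)\<close>. Its expectation is the centring term
      of the linear statistic of the \<open>Z n j\<close>.\<close>
    define W where "W n \<omega> = (\<Sum>j=1..n. S (H n (Y n j \<omega>))) / real n" for n \<omega>
    have W[measurable]: "W n \<in> borel_measurable P" if "n \<ge> 1" for n
      unfolding W_def[abs_def] using that Ym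
      by (intro borel_measurable_divide borel_measurable_sum borel_measurable_const
          measurable_compose[OF Ym measurable_compose[OF H]]) auto
    have Wb: "\<bar>W n \<omega>\<bar> \<le> B" if "n \<ge> 1" for n \<omega>
    proof -
      have "\<bar>\<Sum>j=1..n. S (H n (Y n j \<omega>))\<bar> \<le> (\<Sum>j=1..n. B)"
        using Sb by (intro order_trans[OF sum_abs] sum_mono) auto
      then show ?thesis using that by (simp add: W_def abs_divide divide_le_eq mult.commute)
    qed
    have mW: "(\<Sum>i<n. m n i) / real n = (\<integral>\<omega>. W n \<omega> \<partial>P)" if n: "n \<ge> 1" for n
    proof -
      have "m n i = (\<integral>\<omega>. S (H n (Y n (Suc i) \<omega>)) \<partial>P)" if i: "i < n" for i
        unfolding m_def g_def S_def
        using i by (intro radial_measure_integral[OF P Ym H[OF n] Ypos polar[OF n i] _ s]) auto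
      then have "(\<Sum>i<n. m n i) = (\<Sum>i<n. \<integral>\<omega>. S (H n (Y n (Suc i) \<omega>)) \<partial>P)" by simp
      also have "\<dots> = (\<Sum>j=1..n. \<integral>\<omega>. S (H n (Y n j \<omega>)) \<partial>P)"
        by (rule sum.reindex_bij_witness[of _ "\<lambda>j. j - 1" Suc]) auto
      also have "\<dots> = (\<integral>\<omega>. (\<Sum>j=1..n. S (H n (Y n j \<omega>))) \<partial>P)"
        using Sb n Ym by (intro Bochner_Integration.integral_sum[symmetric] P.integrable_const_bound[where B=B]
           measurable_compose[OF Ym measurable_compose[OF H]]) auto
      finally show ?thesis by (simp add: W_def)
    qed
    have "AE \<omega> in P. (\<lambda>n. W n \<omega>) \<longlonglongrightarrow> (\<integral>r. S r \<partial>\<nu>)"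
    proof -
      have "AE \<omega> in P. \<forall>n. \<forall>j\<in>{1..n}. 0 < Y n j \<omega>"
        using Ypos by (simp add: AE_all_countable AE_ball_countable)
      with conv[unfolded as_weakly_converges_def] show ?thesis
      proof eventually_elim
        case (elim \<omega>)
        have W_eq: "(\<integral>r. S r \<partial>empirical_measure n (\<lambda>j. h n (Y n j \<omega>))) = W n \<omega>" for n
          using elim(2) by (simp add: integral_empirical_measure W_def H_def less_imp_le
              cong: sum.cong_simp)
        have "bounded (range S)" using Sb by (auto simp: bounded_iff)
        with Sc elim(1)[unfolded weakly_converges_def, rule_format, of S] show ?case
          by (simp only: W_eq simp_thms)
      qed
    qed
    \<comment> \<open>Dominated convergence asks for measurability and a bound at every index, and
      both were shown for \<open>n \<ge> 1\<close>; hence the shift.\<close>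
    then have "(\<lambda>n. \<integral>\<omega>. W (Suc n) \<omega> \<partial>P) \<longlonglongrightarrow> (\<integral>\<omega>. (\<integral>r. S r \<partial>\<nu>) \<partial>P)"
      using Wb by (intro integral_dominated_convergence[where w="\<lambda>_. B"])
        (auto elim!: eventually_mono intro: LIMSEQ_Suc)
    then have lim: "(\<lambda>n. \<integral>\<omega>. W (Suc n) \<omega> \<partial>P) \<longlonglongrightarrow> (\<integral>r. S r \<partial>\<nu>)"
      by (simp add: P.prob_space)
    have mean: "(\<lambda>n. (\<Sum>i<n. m n i) / real n) \<longlonglongrightarrow> (\<integral>r. S r \<partial>\<nu>)"
    proof (rule LIMSEQ_imp_Suc)
      show "(\<lambda>n. (\<Sum>i<Suc n. m (Suc n) i) / real (Suc n)) \<longlonglongrightarrow> (\<integral>r. S r \<partial>\<nu>)"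
        using lim by (subst mW) auto
    qed
    have sP: "(\<integral>r. S r \<partial>\<nu>) = (\<integral>x. s x \<partial>(unif_angle \<Otimes>\<^sub>M \<nu>))"
    proof -
      have "s \<in> borel_measurable (unif_angle \<Otimes>\<^sub>M \<nu>)" by measurable
      then have "integrable (unif_angle \<Otimes>\<^sub>M \<nu>) s"
        using sb by (intro UV.P.integrable_const_bound[where B=B]) auto
      then show ?thesis
        using UV.integral_snd[of "\<lambda>\<theta> r. s (\<theta>, r)"] by (simp add: S_def)
    qed
    have "AE \<omega> in P. (\<lambda>n. (\<Sum>j=1..n. g n (Z n j \<omega>)) / real n - (\<Sum>i<n. m n i) / real n) \<longlonglongrightarrow> 0"
    proof (rule P.AE_tendsto_zero_geometric)
      show "(\<lambda>\<omega>. (\<Sum>j=1..n. g n (Z n j \<omega>)) / real n - (\<Sum>i<n. m n i) / real n) \<in> borel_measurable P"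
        if "n \<ge> 1" for n
        using that by (intro borel_measurable_diff borel_measurable_divide borel_measurable_sum borel_measurable_const
          measurable_compose[OF Zm g]) auto
      fix e :: real assume e: "e > 0"
      have "P.prob {\<omega> \<in> space P. e \<le> \<bar>(\<Sum>j=1..n. g n (Z n j \<omega>)) / real n - (\<Sum>i<n. m n i) / real n\<bar>}
          \<le> 2 * exp (- (e\<^sup>2 / (2 * B\<^sup>2))) ^ n" if n: "n \<ge> 1" for n
        unfolding m_def
        by (rule radial_ensemble_concentration[OF P n u[OF n] u0[OF n] Zu[OF n] Zm[OF n] a[OF n] N[OF n] g[OF n] _ B e])
          (use sb in \<open>auto simp: g_def\<close>)
      moreover have "exp (- (e\<^sup>2 / (2 * B\<^sup>2))) < 1" using e B by simp
      ultimately show "\<exists>q C. 0 \<le> q \<and> q < 1 \<and> (\<forall>n\<ge>1. P.prob {\<omega> \<in> space P.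
          e \<le> \<bar>(\<Sum>j=1..n. g n (Z n j \<omega>)) / real n - (\<Sum>i<n. m n i) / real n\<bar>} \<le> C * q ^ n)"
        by (intro exI[of _ "exp (- (e\<^sup>2 / (2 * B\<^sup>2)))"] exI[of _ 2]) auto
    qed
    then show ?thesis
    proof eventually_elim
      case (elim \<omega>)
      have "(\<lambda>n. (\<Sum>j=1..n. g n (Z n j \<omega>)) / real n) \<longlonglongrightarrow> (\<integral>x. s x \<partial>(unif_angle \<Otimes>\<^sub>M \<nu>))"
        using tendsto_add[OF elim mean] by (simp add: sP)
      then show ?case
        by (simp add: integral_empirical_measure g_def H_def)
    qed
  qed
  obtain D :: "(real \<times> real) set" where D: "countable D" "\<And>U. open U \<Longrightarrow> U \<noteq> {} \<Longrightarrow> \<exists>d\<in>D. d \<in> U"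
    using countable_dense_exists by blast
  have "AE \<omega> in P. \<forall>ps\<in>lists (D \<times> UNIV).
    (\<lambda>n. \<integral>x. tent_max ps x \<partial>empirical_measure n (\<lambda>j. (Arg2pi (Z n j \<omega>), h n (cmod (Z n j \<omega>)))))
      \<longlonglongrightarrow> (\<integral>x. tent_max ps x \<partial>(unif_angle \<Otimes>\<^sub>M \<nu>))"
  proof (rule AE_ball_countable')
    show "countable (lists (D \<times> (UNIV :: (nat \<times> nat) set)))" using D(1) by auto
    fix ps :: "((real \<times> real) \<times> nat \<times> nat) list"
    obtain B where "\<And>x. tent_max ps x \<le> B" using tent_max_bounded by blast
    then have "\<And>x. tent_max ps x \<le> max B 1" by (simp add: le_max_iff_disj)
    then show "AE \<omega> in P. (\<lambda>n. \<integral>x. tent_max ps x \<partial>empirical_measure n (\<lambda>j. (Arg2pi (Z n j \<omega>), h n (cmod (Z n j \<omega>)))))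
      \<longlonglongrightarrow> (\<integral>x. tent_max ps x \<partial>(unif_angle \<Otimes>\<^sub>M \<nu>))"
      by (intro single[OF continuous_on_tent_max tent_max_nonneg]) auto
  qed
  then show ?thesis
    unfolding as_weakly_converges_def
  proof eventually_elim
    case (elim \<omega>)
    have "sets (unif_angle \<Otimes>\<^sub>M \<nu>) = sets borel"
      unfolding borel_prod[symmetric] by (rule sets_pair_measure_cong) auto
    then show ?case
      using elim D by (intro weakly_converges_tentI[where D=D] prob_space_empirical_measure)
        (auto simp: empirical_measure_def UV.P.prob_space_axioms)
  qed
qed

theorem theorem1:
  fixes P :: "'a measure"
    and \<phi> :: "nat \<Rightarrow> real \<Rightarrow> real"
    and Z :: "nat \<Rightarrow> nat \<Rightarrow> 'a \<Rightarrow> complex"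
    and Y :: "nat \<Rightarrow> nat \<Rightarrow> 'a \<Rightarrow> real"
  assumes "prob_space P"
    and "\<And>n. n \<ge> 1 \<Longrightarrow> \<phi> n \<in> borel_measurable (restrict_space borel {0..})"
    and "\<And>n x. n \<ge> 1 \<Longrightarrow> x \<ge> 0 \<Longrightarrow> \<phi> n x \<ge> 0"
    and "\<And>n. n \<ge> 1 \<Longrightarrow>
      density_proportional_to P (\<Pi>\<^sub>M j\<in>{1..n}. lborel) (\<lambda>\<omega>. \<lambda>j\<in>{1..n}. Z n j \<omega>)
        (\<lambda>z. (\<Prod>(j, k)\<in>{(j, k). 1 \<le> j \<and> j < k \<and> k \<le> n}. (cmod (z j - z k))\<^sup>2) *
             (\<Prod>j=1..n. \<phi> n (cmod (z j))))"
    and "\<And>n. n \<ge> 1 \<Longrightarrow> prob_space.indep_vars P (\<lambda>_. borel) (Y n) {1..n}"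
    and "\<And>n j. 1 \<le> j \<Longrightarrow> j \<le> n \<Longrightarrow>
      density_proportional_to P lborel (Y n j)
        (\<lambda>y. y ^ (2 * j - 1) * \<phi> n y * indicator {0..} y)"
  shows "(\<forall>(h :: nat \<Rightarrow> real \<Rightarrow> real) \<nu>.
            (\<forall>n\<ge>1. h n \<in> borel_measurable (restrict_space borel {0..})) \<longrightarrow>
            real_distribution \<nu> \<longrightarrow>
            as_weakly_converges P (\<lambda>n \<omega>. empirical_measure n (\<lambda>j. h n (Y n j \<omega>))) \<nu> \<longrightarrow>
            as_weakly_converges P
              (\<lambda>n \<omega>. empirical_measure n (\<lambda>j. (Arg2pi (Z n j \<omega>), h n (cmod (Z n j \<omega>)))))
              (uniform_measure lborel {0..2 * pi} \<Otimes>\<^sub>M \<nu>)) \<and>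
         (\<forall>(a :: nat \<Rightarrow> real) \<nu>.
            (\<forall>n\<ge>1. a n > 0) \<longrightarrow>
            real_distribution \<nu> \<longrightarrow>
            as_weakly_converges P (\<lambda>n \<omega>. empirical_measure n (\<lambda>j. Y n j \<omega> / a n)) \<nu> \<longrightarrow>
            as_weakly_converges P
              (\<lambda>n \<omega>. empirical_measure n (\<lambda>j. Z n j \<omega> / complex_of_real (a n)))
              (distr (uniform_measure lborel {0..2 * pi} \<Otimes>\<^sub>M \<nu>) borel
                (\<lambda>(\<theta>, r). complex_of_real r * exp (\<i> * complex_of_real \<theta>))))"
proof -
  note polar = empirical_polar_as_convergence[OF assms(1-4,6)]
  have part1: "as_weakly_converges P
      (\<lambda>n \<omega>. empirical_measure n (\<lambda>j. (Arg2pi (Z n j \<omega>), h n (cmod (Z n j \<omega>))))) (unif_angle \<Otimes>\<^sub>M \<nu>)"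
    if "\<forall>n\<ge>1. h n \<in> borel_measurable (restrict_space borel {0..})" "real_distribution \<nu>"
      "as_weakly_converges P (\<lambda>n \<omega>. empirical_measure n (\<lambda>j. h n (Y n j \<omega>))) \<nu>"
    for h :: "nat \<Rightarrow> real \<Rightarrow> real" and \<nu>
    using that by (intro polar) auto
  have part2: "as_weakly_converges P
      (\<lambda>n \<omega>. empirical_measure n (\<lambda>j. Z n j \<omega> / complex_of_real (a n)))
      (distr (unif_angle \<Otimes>\<^sub>M \<nu>) borel (\<lambda>(\<theta>, r). complex_of_real r * exp (\<i> * complex_of_real \<theta>)))"
    if \<nu>: "real_distribution \<nu>"
      and conv: "as_weakly_converges P (\<lambda>n \<omega>. empirical_measure n (\<lambda>j. Y n j \<omega> / a n)) \<nu>"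
    for a :: "nat \<Rightarrow> real" and \<nu>
  proof -
    interpret V: real_distribution \<nu> by fact
    let ?\<Psi> = "\<lambda>(\<theta>, r). complex_of_real r * exp (\<i> * complex_of_real \<theta>)"
    have \<Psi>: "continuous_on UNIV ?\<Psi>"
      unfolding case_prod_unfold by (intro continuous_intros)
    \<comment> \<open>Part (i) with \<open>h n y = y / a n\<close>; the polar map
      \<open>?\<Psi>\<close> is continuous and sends each atom back to the rescaled point.\<close>
    have "as_weakly_converges P
        (\<lambda>n \<omega>. empirical_measure n (\<lambda>j. (Arg2pi (Z n j \<omega>), cmod (Z n j \<omega>) / a n))) (unif_angle \<Otimes>\<^sub>M \<nu>)"
      using \<nu> conv by (intro part1[of "\<lambda>n y. y / a n"]) (auto intro!: measurable_restrict_space1)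
    then show ?thesis
      unfolding as_weakly_converges_def
    proof eventually_elim
      case (elim \<omega>)
      have sets: "sets (unif_angle \<Otimes>\<^sub>M \<nu>) = sets borel"
        unfolding borel_prod[symmetric] by (rule sets_pair_measure_cong) auto
      have eq: "Z n j \<omega> / complex_of_real (a n) =
          ?\<Psi> (Arg2pi (Z n j \<omega>), cmod (Z n j \<omega>) / a n)" for n j
        by (subst Arg2pi_eq[of "Z n j \<omega>"]) simp
      have "weakly_converges
          (\<lambda>n. distr (empirical_measure n (\<lambda>j. (Arg2pi (Z n j \<omega>), cmod (Z n j \<omega>) / a n))) borel ?\<Psi>)
          (distr (unif_angle \<Otimes>\<^sub>M \<nu>) borel ?\<Psi>)"
        by (rule weakly_converges_distr[OF elim \<Psi> _ sets]) (simp add: empirical_measure_def)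
      then show ?case
        unfolding distr_empirical_measure[OF borel_measurable_continuous_onI[OF \<Psi>]] eq .
    qed
  qed
  show ?thesis using part1 part2 by blast
qed

end
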